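(* For a four-vortex collinear relative equilibrium with coordinates $x_1,\dots,x_4$ on a line, circulations $\Gamma_1,\dots,\Gamma_4$ and angular velocity $\omega$, the nontrivial eigenvalues of the matrix $A$ are the roots of $\lambda^2-T\lambda+D$, where $$T=\omega^{-1}\sum_{1\le i<j\le 4}\frac{\Gamma_i+\Gamma_j}{r_{ij}^2}-1,\qquad D=-T+\omega^{-2}\delta .$$ When $\Gamma_1=\Gamma_2=\Gamma_3=1$ and $\Gamma_4=m$, for a fixed $m$ these nontrivial eigenvalues are identical for all solutions within a particular group of orderings (Group I or Group II). Sufficient conditions for linear stability of the relative equilibrium are $$\text{(i) } -2<T<2,\qquad \text{(ii) } D<T^2/4,\qquad \text{(iii) } D>T-1,\qquad\text{and}\qquad \text{(iv) } D>-T-1 .$$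
   Context: Relative equilibria: distinct positions $z_i\in\mathbb{R}^2$ with $-\omega(z_i-c)=\sum_{j\ne i}\frac{\Gamma_j}{r_{ij}^2}(z_j-z_i)$ for all $i$, where $r_{ij}=\|z_i-z_j\|$, $\omega\neq0$, $c=\frac1\Gamma\sum_i\Gamma_iz_i$ is the center of vorticity, $\Gamma=\sum_i\Gamma_i\ne0$. Also assume $L=\sum_{i<j}\Gamma_i\Gamma_j\neq 0$. Collinear: $z_i=(x_i,0)$. The quantity $\delta$ is $$\delta=\frac{(\Gamma_1+\Gamma_2)(\Gamma_3+\Gamma_4)}{r_{12}^2r_{34}^2}+\frac{(\Gamma_1+\Gamma_3)(\Gamma_2+\Gamma_4)}{r_{13}^2r_{24}^2}+\frac{(\Gamma_1+\Gamma_4)(\Gamma_2+\Gamma_3)}{r_{14}^2r_{23}^2}+\sum_{i=1}^4\ \sum_{\substack{j<k\\ j,k\neq i}}\frac{\Gamma_i(\Gamma_i+\Gamma_j+\Gamma_k)}{r_{ij}^2r_{ik}^2}.$$ The $4\times4$ matrix $A$ has entries $A_{ij}=-\omega^{-1}\Gamma_jr_{ij}^{-2}$ for $i\neq j$ and $A_{ii}=-\sum_{j\ne i}A_{ij}$. After translating so that $c=0$, the vectors $[1,1,1,1]^T$ and $[x_1,x_2,x_3,x_4]^T$ are eigenvectors of $A$ with eigenvalues $0$ and $1$ (the trivial eigenvalues); the other two eigenvalues of $A$ (with multiplicity) are its nontrivial eigenvalues. Groups of orderings (for $\Gamma_1=\Gamma_2=\Gamma_3=1,\Gamma_4=m$):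 normalize $x_1=-1,x_2=1$; ordering $(i\,j\,k\,l)$ means $x_i<x_j<x_k<x_l$. Group I: $(1\,2\,3\,4),(4\,3\,1\,2),(4\,1\,2\,3),(1\,3\,2\,4),(3\,1\,2\,4),(4\,1\,3\,2)$. Group II: $(1\,2\,4\,3),(3\,4\,1\,2),(1\,4\,2\,3),(1\,3\,4\,2),(3\,1\,4\,2),(1\,4\,3\,2)$. Within each group, for given $m$ the solutions are images of one another under relabeling the three equal vortices followed by the scaling and translation restoring $x_1=-1,x_2=1$. Linear stability (in the full plane), with $c=0$ and $z_0=(z_1,\dots,z_4)$: the scaled stability matrix is $\omega^{-1}B=K(\omega^{-1}M^{-1}D^2H(z_0)+I)$, with $H=-\sum_{i<j}\Gamma_i\Gamma_j\ln r_{ij}$, $M=\mathrm{diag}\{\Gamma_1,\Gamma_1,\dots,\Gamma_4,\Gamma_4\}$, $K$ block-diagonal with blocks $\begin{bmatrix}0&1\\-1&0\end{bmatrix}$. In coordinates $(x_1,\dots,x_4,y_1,\dots,y_4)$ a collinear solution has $\omega^{-1}B=\begin{bmatrix}0&I-A\\-(I+A)&0\end{bmatrix}$. Its eigenvalues always include the trivial ones $0,0,\pm i$; the other four are the nontrivial ones. Let $V=\mathrm{span}\{z_0,Kz_0\}$ and $V^\perp=\{w\in\mathbb{R}^8:w^TMv=0\ \forall v\in V\}$. The relative equilibrium is linearly stable if the nontrivial eigenvalues are nonzero, lie on the imaginary axis, and the restriction of $\omega^{-1}B$ to $V^\perp$ has a block-diagonal real Jordan form with blocks $\begin{bmatrix}0&\beta_i\\-\beta_i&0\end{bmatrix}$.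 *)

theory Defs
  imports "HOL-Analysis.Analysis" "HOL-Computational_Algebra.Polynomial"
begin

text \<open>
  The four vortices are indexed by the type \<^typ>\<open>4\<close>, whose elements are
  \<open>1, 2, 3, 4\<close>; there the numeral \<open>4\<close> denotes the same element as \<open>0\<close>, so the order of the
  type is \<open>4 < 1 < 2 < 3\<close>.  A sum over \<open>i < j\<close> still meets every two-element set of
  indices exactly once, and is used only with summands symmetric in \<open>i\<close> and \<open>j\<close>.

  A planar configuration is a vector of \<open>\<real>\<^sup>8\<close> with coordinates indexed by pairs
  (vortex, axis): entry \<open>(i, 1)\<close> is the \<open>x\<close>-coordinate of vortex \<open>i\<close> and \<open>(i, 2)\<close> its
  \<open>y\<close>-coordinate.
\<close>

type_synonym config = "real ^ (4 \<times> 2)"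

definition vortex :: "config \<Rightarrow> 4 \<Rightarrow> real ^ 2" where
  "vortex z i = (\<chi> k. z $ (i, k))"

definition r :: "config \<Rightarrow> 4 \<Rightarrow> 4 \<Rightarrow> real" where
  "r z i j = dist (vortex z i) (vortex z j)"

definition on_line :: "real ^ 4 \<Rightarrow> config" where
  "on_line x = (\<chi> p. if snd p = 1 then x $ fst p else 0)"


subsection \<open>Relative equilibria\<close>

definition total_circ :: "real ^ 4 \<Rightarrow> real" where
  "total_circ \<Gamma> = (\<Sum>i\<in>UNIV. \<Gamma> $ i)"

definition L :: "real ^ 4 \<Rightarrow> real" where
  "L \<Gamma> = (\<Sum>(i, j)\<in>{(i, j). i < j}. \<Gamma> $ i * \<Gamma> $ j)"

definition center :: "real ^ 4 \<Rightarrow> config \<Rightarrow> real ^ 2" where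
  "center \<Gamma> z = (1 / total_circ \<Gamma>) *\<^sub>R (\<Sum>i\<in>UNIV. \<Gamma> $ i *\<^sub>R vortex z i)"

definition relative_equilibrium :: "real ^ 4 \<Rightarrow> real \<Rightarrow> config \<Rightarrow> bool" where
  "relative_equilibrium \<Gamma> \<omega> z \<longleftrightarrow>
     total_circ \<Gamma> \<noteq> 0 \<and> \<omega> \<noteq> 0 \<and> inj (vortex z) \<and>
     (\<forall>i. - \<omega> *\<^sub>R (vortex z i - center \<Gamma> z) =
          (\<Sum>j\<in>UNIV - {i}. (\<Gamma> $ j / (r z i j)\<^sup>2) *\<^sub>R (vortex z j - vortex z i)))"


subsection \<open>Eigenvalues with multiplicity\<close>

definition charpoly :: "real ^ 'n ^ 'n \<Rightarrow> complex poly" where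
  "charpoly A = det (\<chi> i j. (if i = j then [:0, 1:] else 0) - [:complex_of_real (A $ i $ j):])"

definition eigenvals :: "real ^ 'n ^ 'n \<Rightarrow> complex multiset" where
  "eigenvals A = proots (charpoly A)"


subsection \<open>The matrix of a collinear relative equilibrium\<close>

definition A_mat :: "real ^ 4 \<Rightarrow> real \<Rightarrow> config \<Rightarrow> real ^ 4 ^ 4" where
  "A_mat \<Gamma> \<omega> z = (\<chi> i j.
     if i \<noteq> j then - inverse \<omega> * \<Gamma> $ j / (r z i j)\<^sup>2
     else - (\<Sum>k\<in>UNIV - {i}. - inverse \<omega> * \<Gamma> $ k / (r z i k)\<^sup>2))"

text \<open>For a collinear relative equilibrium, \<open>0\<close> and \<open>1\<close> are eigenvalues of \<open>A\<close> (eigenvectors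
  \<open>[1,1,1,1]\<close> and \<open>[x\<^sub>i - c]\<close>), so the difference removes exactly one copy of each.\<close>

definition nontrivial_eigenvals_A :: "real ^ 4 \<Rightarrow> real \<Rightarrow> config \<Rightarrow> complex multiset" where
  "nontrivial_eigenvals_A \<Gamma> \<omega> z = eigenvals (A_mat \<Gamma> \<omega> z) - {#0, 1#}"

definition \<delta> :: "real ^ 4 \<Rightarrow> config \<Rightarrow> real" where
  "\<delta> \<Gamma> z =
     (\<Gamma>$1 + \<Gamma>$2) * (\<Gamma>$3 + \<Gamma>$4) / ((r z 1 2)\<^sup>2 * (r z 3 4)\<^sup>2)
   + (\<Gamma>$1 + \<Gamma>$3) * (\<Gamma>$2 + \<Gamma>$4) / ((r z 1 3)\<^sup>2 * (r z 2 4)\<^sup>2)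
   + (\<Gamma>$1 + \<Gamma>$4) * (\<Gamma>$2 + \<Gamma>$3) / ((r z 1 4)\<^sup>2 * (r z 2 3)\<^sup>2)
   + (\<Sum>i\<in>UNIV. \<Sum>(j, k)\<in>{(j, k). j < k \<and> j \<noteq> i \<and> k \<noteq> i}.
        \<Gamma>$i * (\<Gamma>$i + \<Gamma>$j + \<Gamma>$k) / ((r z i j)\<^sup>2 * (r z i k)\<^sup>2))"

definition T_coeff :: "real ^ 4 \<Rightarrow> real \<Rightarrow> config \<Rightarrow> real" where
  "T_coeff \<Gamma> \<omega> z =
     inverse \<omega> * (\<Sum>(i, j)\<in>{(i, j). i < j}. (\<Gamma>$i + \<Gamma>$j) / (r z i j)\<^sup>2) - 1"

definition D_coeff :: "real ^ 4 \<Rightarrow> real \<Rightarrow> config \<Rightarrow> real" where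
  "D_coeff \<Gamma> \<omega> z = - T_coeff \<Gamma> \<omega> z + (inverse \<omega>)\<^sup>2 * \<delta> \<Gamma> z"


subsection \<open>Groups of orderings\<close>

definition group_I :: "4 list set" where
  "group_I = {[1,2,3,4], [4,3,1,2], [4,1,2,3], [1,3,2,4], [3,1,2,4], [4,1,3,2]}"

definition group_II :: "4 list set" where
  "group_II = {[1,2,4,3], [3,4,1,2], [1,4,2,3], [1,3,4,2], [3,1,4,2], [1,4,3,2]}"

definition normalized_in :: "4 list set \<Rightarrow> real ^ 4 \<Rightarrow> bool" where
  "normalized_in G x \<longleftrightarrow>
     x $ 1 = -1 \<and> x $ 2 = 1 \<and> (\<exists>ord\<in>G. sorted_wrt (\<lambda>i j. x $ i < x $ j) ord)"


subsection \<open>Linear stability in the plane\<close>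

definition hamiltonian :: "real ^ 4 \<Rightarrow> config \<Rightarrow> real" where
  "hamiltonian \<Gamma> z = - (\<Sum>(i, j)\<in>{(i, j). i < j}. \<Gamma> $ i * \<Gamma> $ j * ln (r z i j))"

definition partial_deriv :: "'n::finite \<Rightarrow> (real ^ 'n \<Rightarrow> real) \<Rightarrow> real ^ 'n \<Rightarrow> real" where
  "partial_deriv p f z = deriv (\<lambda>t. f (z + t *\<^sub>R axis p 1)) 0"

definition hessian :: "(real ^ 'n \<Rightarrow> real) \<Rightarrow> real ^ 'n::finite \<Rightarrow> real ^ 'n ^ 'n" where
  "hessian f z = (\<chi> p q. partial_deriv p (partial_deriv q f) z)"

definition M_mat :: "real ^ 4 \<Rightarrow> real ^ (4 \<times> 2) ^ (4 \<times> 2)" where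
  "M_mat \<Gamma> = (\<chi> p q. if p = q then \<Gamma> $ fst p else 0)"

definition K_mat :: "real ^ (4 \<times> 2) ^ (4 \<times> 2)" where
  "K_mat = (\<chi> p q. if fst p = fst q
     then (if snd p = 1 \<and> snd q = 2 then 1 else if snd p = 2 \<and> snd q = 1 then -1 else 0)
     else 0)"

text \<open>The matrix \<open>\<omega>\<^sup>-\<^sup>1B\<close>; it is meaningful when no circulation vanishes, so that \<open>M\<close> is
  invertible.\<close>

definition stability_matrix ::
  "real ^ 4 \<Rightarrow> real \<Rightarrow> config \<Rightarrow> real ^ (4 \<times> 2) ^ (4 \<times> 2)" where
  "stability_matrix \<Gamma> \<omega> z0 =
     K_mat ** (inverse \<omega> *\<^sub>R (matrix_inv (M_mat \<Gamma>) ** hessian (hamiltonian \<Gamma>) z0) + mat 1)"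

definition centered :: "real ^ 4 \<Rightarrow> config \<Rightarrow> config" where
  "centered \<Gamma> z = (\<chi> p. z $ p - center \<Gamma> z $ snd p)"

definition V_space :: "config \<Rightarrow> config set" where
  "V_space z0 = span {z0, K_mat *v z0}"

definition V_perp :: "real ^ 4 \<Rightarrow> config \<Rightarrow> config set" where
  "V_perp \<Gamma> z0 = {w. \<forall>v\<in>V_space z0. w \<bullet> (M_mat \<Gamma> *v v) = 0}"

text \<open>\<open>B\<close> restricted to the subspace \<open>W\<close> has, in a suitable basis of \<open>W\<close>, a block-diagonal matrix
  with \<open>k\<close> blocks \<open>[0, \<beta>; -\<beta>, 0]\<close>: the columns of a block are the images of its two basis
  vectors.\<close>

definition rotation_block_form :: "real ^ 'n ^ 'n \<Rightarrow> (real ^ 'n) set \<Rightarrow> bool" where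
  "rotation_block_form B W \<longleftrightarrow>
     (\<exists>k bs (\<beta> :: nat \<Rightarrow> real).
        length bs = 2 * k \<and> distinct bs \<and> independent (set bs) \<and> span (set bs) = W \<and>
        (\<forall>i<k. B *v (bs ! (2 * i)) = - \<beta> i *\<^sub>R bs ! (2 * i + 1) \<and>
               B *v (bs ! (2 * i + 1)) = \<beta> i *\<^sub>R bs ! (2 * i)))"

definition linearly_stable :: "real ^ 4 \<Rightarrow> real \<Rightarrow> config \<Rightarrow> bool" where
  "linearly_stable \<Gamma> \<omega> z \<longleftrightarrow>
     (let z0 = centered \<Gamma> z; B = stability_matrix \<Gamma> \<omega> z0 in
        (\<forall>\<mu>\<in>#eigenvals B - {#0, 0, \<i>, - \<i>#}. \<mu> \<noteq> 0 \<and> Re \<mu> = 0) \<and>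
        rotation_block_form B (V_perp \<Gamma> z0))"

end

theory Submission
  imports Defs
begin

text \<open>
  The matrix \<open>A\<close> is a weighted graph Laplacian with eigenvalues \<open>0\<close> and \<open>1\<close>, so its trace and the sum of
  its principal \<open>2 \<times> 2\<close> minors determine the two other eigenvalues.

  For circulations \<open>1, 1, 1, m\<close>, measure the equal vortices from the fourth one in units of its
  signed distance \<open>d\<close> from the center. Their positions are the roots of a cubic whose coefficients are
  functions of \<open>m\<close> and \<open>w = \<omega> d\<^sup>2\<close>, and \<open>w\<close> satisfies a quadratic equation over \<open>\<real>(m)\<close>.
  Comparing the equations of motion for pairs of vortices excludes \<open>m < -1\<close>, and for \<open>m > -1\<close> at most one root
  of the quadratic is compatible with the fourth vortex being outermost, and at most one with its
  being between two others. Hence two solutions in the same group agree up to scaling, translation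
  and relabeling.

  For stability, \<open>A\<close> is selfadjoint for the form with weights \<open>\<Gamma>\<close>, so the plane orthogonal to
  \<open>(1,1,1,1)\<close> and to the position vector is invariant. There \<open>A\<close> has two distinct eigenvalues
  \<open>\<lambda>\<close>, which (i)--(iv) place in \<open>(-1, 1)\<close>, and each of them contributes
  to \<open>\<omega>\<^sup>-\<^sup>1B\<close> a rotation block with \<open>\<beta>\<^sup>2 = 1 - \<lambda>\<^sup>2\<close>.
\<close>

subsection \<open>Characteristic polynomials\<close>

lemma det_4:
  "det (A::'a::comm_ring_1^4^4) =
     A$1$1 * A$2$2 * A$3$3 * A$4$4 - A$1$1 * A$2$2 * A$3$4 * A$4$3
   - A$1$1 * A$2$3 * A$3$2 * A$4$4 + A$1$1 * A$2$3 * A$3$4 * A$4$2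
   + A$1$1 * A$2$4 * A$3$2 * A$4$3 - A$1$1 * A$2$4 * A$3$3 * A$4$2
   - A$1$2 * A$2$1 * A$3$3 * A$4$4 + A$1$2 * A$2$1 * A$3$4 * A$4$3
   + A$1$2 * A$2$3 * A$3$1 * A$4$4 - A$1$2 * A$2$3 * A$3$4 * A$4$1
   - A$1$2 * A$2$4 * A$3$1 * A$4$3 + A$1$2 * A$2$4 * A$3$3 * A$4$1
   + A$1$3 * A$2$1 * A$3$2 * A$4$4 - A$1$3 * A$2$1 * A$3$4 * A$4$2
   - A$1$3 * A$2$2 * A$3$1 * A$4$4 + A$1$3 * A$2$2 * A$3$4 * A$4$1
   + A$1$3 * A$2$4 * A$3$1 * A$4$2 - A$1$3 * A$2$4 * A$3$2 * A$4$1
   - A$1$4 * A$2$1 * A$3$2 * A$4$3 + A$1$4 * A$2$1 * A$3$3 * A$4$2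
   + A$1$4 * A$2$2 * A$3$1 * A$4$3 - A$1$4 * A$2$2 * A$3$3 * A$4$1
   - A$1$4 * A$2$3 * A$3$1 * A$4$2 + A$1$4 * A$2$3 * A$3$2 * A$4$1"
proof -
  have f1: "finite {2::4, 3, 4}" "1 \<notin> {2::4, 3, 4}"
    by auto
  have f2: "finite {3::4, 4}" "2 \<notin> {3::4, 4}"
    by auto
  have f3: "finite {4::4}" "3 \<notin> {4::4}"
    by auto
  show ?thesis
    unfolding det_def UNIV_4
    unfolding sum_over_permutations_insert[OF f1]
    unfolding sum_over_permutations_insert[OF f2]
    unfolding sum_over_permutations_insert[OF f3]
    unfolding permutes_sing
    by (simp add: sign_swap_id permutation_swap_id sign_compose sign_id swap_id_eq
        permutation_compose transpose_def algebra_simps)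
qed

text \<open>The pairs that contain 4 have it in first place because \<open>4\<close> is the least
  element of the index type.\<close>

lemma sum_pairs_4:
  "(\<Sum>(i, j)\<in>{(i, j). i < j}. f i j) =
     f 4 1 + f 4 2 + f 4 3 + f 1 2 + f 1 3 + f (2::4) (3::4)"
proof -
  have "{(i, j). i < (j::4)} = {(4,1), (4,2), (4,3), (1,2), (1,3), (2,3)}"
  proof (intro set_eqI, clarify)
    fix i j :: 4
    show "((i, j) \<in> {(i, j). i < j}) = ((i, j) \<in> {(4,1), (4,2), (4,3), (1,2), (1,3), (2,3)})"
      using exhaust_4[of i] exhaust_4[of j] by (elim disjE) (simp_all add: less_bit0_def bit0.Rep_1 bit0.Rep_numeral)
  qed
  then show ?thesis by (simp add: ac_simps)
qed

text \<open>Evaluation at z commutes with the determinant, so characteristic polynomials can be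
  compared as functions of z, through determinants of complex matrices.\<close>

lemma poly_charpoly:
  "poly (charpoly A) z = det (\<chi> i j. (if i = j then z else 0) - complex_of_real (A $ i $ j))"
  by (simp add: charpoly_def det_def poly_sum poly_prod if_distrib[of "\<lambda>p. poly p z"] cong: if_cong)

text \<open>Up to sign the coefficients are the sums of the principal minors; \<open>m2\<close> and
  \<open>m3\<close> are those of sizes 2 and 3.\<close>

lemma charpoly_4:
  fixes A :: "real ^ 4 ^ 4"
  defines "m2 \<equiv> \<lambda>i j. A$i$i * A$j$j - A$i$j * A$j$i"
  defines "m3 \<equiv> \<lambda>i j k. A$i$i * A$j$j * A$k$k + A$i$j * A$j$k * A$k$i + A$i$k * A$j$i * A$k$j
     - A$i$i * A$j$k * A$k$j - A$i$j * A$j$i * A$k$k - A$i$k * A$j$j * A$k$i"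
  shows "charpoly A = map_poly complex_of_real [:det A,
     - (m3 1 2 3 + m3 1 2 4 + m3 1 3 4 + m3 2 3 4),
     m2 1 2 + m2 1 3 + m2 1 4 + m2 2 3 + m2 2 4 + m2 3 4,
     - (A$1$1 + A$2$2 + A$3$3 + A$4$4), 1:]"
  unfolding poly_eq_poly_eq_iff[symmetric] m2_def m3_def
  by (rule ext) (simp add: poly_charpoly det_4 map_poly_pCons algebra_simps)


lemma eigenvector_imp_root_charpoly:
  assumes "A *v v = l *\<^sub>R v" "v \<noteq> 0"
  shows "poly (charpoly A) (complex_of_real l) = 0"
proof -
  define C where "C = (\<chi> i j. (if i = j then l else 0) - A $ i $ j)"
  have "C *v v = 0"
  proof -
    have "(C *v v) $ i = l * v $ i - (A *v v) $ i" for i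
      by (simp add: C_def matrix_vector_mult_def left_diff_distrib sum_subtractf
          if_distrib[of "\<lambda>t. t * _"] cong: if_cong)
    then show ?thesis using assms(1) by (simp add: vec_eq_iff)
  qed
  have "det C = 0"
  proof (rule ccontr)
    assume "det C \<noteq> 0"
    then obtain B where "B ** C = mat 1"
      using invertible_det_nz invertible_left_inverse by blast
    then have "v = B *v (C *v v)"
      by (simp add: matrix_vector_mul_assoc)
    with \<open>C *v v = 0\<close> \<open>v \<noteq> 0\<close> show False by simp
  qed
  moreover have "poly (charpoly A) (complex_of_real l) = complex_of_real (det C)"
    unfolding poly_charpoly det_def C_def
    by (simp add: if_distrib[of complex_of_real] cong: if_cong)
  ultimately show ?thesis by simp
qed

text \<open>The relation \<open>A ** P = P ** N\<close> carries over to the characteristic matrices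
  at each z. Taking determinants, the nonzero determinant of \<open>P\<close> cancels, without an
  inverse of \<open>P\<close>.\<close>

lemma charpoly_similar:
  fixes A N P :: "real ^ 'n ^ 'n"
  assumes AP: "A ** P = P ** N" and P: "det P \<noteq> 0"
  shows "charpoly A = charpoly N"
proof -
  define emb where "emb X = (\<chi> i j. complex_of_real (X $ i $ j))" for X :: "real ^ 'n ^ 'n"
  define C where "C X z = (\<chi> i j. (if i = j then z else 0) - complex_of_real (X $ i $ j))"
    for X :: "real ^ 'n ^ 'n" and z
  have "det (emb P) = complex_of_real (det P)"
    by (simp add: emb_def det_def)
  then have P': "det (emb P) \<noteq> 0"
    using P by simp
  have "poly (charpoly A) z = poly (charpoly N) z" for z
  proof -
    have "(C A z ** emb P) $ i $ j = (emb P ** C N z) $ i $ j" for i j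
    proof -
      have "(C A z ** emb P) $ i $ j = z * emb P $ i $ j - complex_of_real ((A ** P) $ i $ j)"
        by (simp add: C_def emb_def matrix_matrix_mult_def left_diff_distrib sum_subtractf
            if_distrib[of "\<lambda>t. t * _"] cong: if_cong)
      also have "\<dots> = (emb P ** C N z) $ i $ j"
        unfolding AP
        by (simp add: C_def emb_def matrix_matrix_mult_def right_diff_distrib sum_subtractf
            if_distrib[of "\<lambda>t. _ * t"] cong: if_cong)
      finally show ?thesis .
    qed
    then have "C A z ** emb P = emb P ** C N z"
      by (simp add: vec_eq_iff)
    then have "det (C A z) * det (emb P) = det (emb P) * det (C N z)"
      by (metis det_mul)
    then show ?thesis
      using P' by (simp add: poly_charpoly C_def)
  qed
  then show ?thesis
    by (simp add: poly_eq_poly_eq_iff[symmetric] ext)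
qed

text \<open>Permuting rows and columns by the same \<open>p\<close> multiplies the determinant by
  the square of the sign of \<open>p\<close>.\<close>

lemma charpoly_permute:
  fixes A :: "real ^ 'n ^ 'n"
  assumes "p permutes UNIV"
  shows "charpoly (\<chi> i j. A $ p i $ p j) = charpoly A"
proof -
  define C where "C = (\<chi> i j. (if i = j then [:0, 1:] else 0) - [:complex_of_real (A $ i $ j):])"
  have "inj p"
    using assms by (rule permutes_inj)
  then have "charpoly (\<chi> i j. A $ p i $ p j) = det (\<chi> i j. C $ p i $ p j)"
    by (simp add: charpoly_def C_def inj_eq)
  also have "(\<chi> i j. C $ p i $ p j) = (\<chi> i j. (\<chi> i. C $ p i) $ i $ p j)"
    by (simp add: vec_eq_iff)
  also have "det \<dots> = of_int (sign p) * (of_int (sign p) * det C)"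
    unfolding det_permute_columns[OF assms] det_permute_rows[OF assms] ..
  also have "\<dots> = det C"
    by (simp add: mult.assoc[symmetric] sign_idempotent flip: of_int_mult)
  finally show ?thesis
    by (simp add: charpoly_def C_def)
qed

subsection \<open>The matrix of a collinear equilibrium\<close>

lemma r_on_line: "r (on_line x) i j = \<bar>x $ i - x $ j\<bar>"
proof -
  have "vortex (on_line x) i = (x $ i) *\<^sub>R axis 1 1" for i
    by (simp add: vortex_def on_line_def vec_eq_iff axis_def forall_2)
  then have "vortex (on_line x) i - vortex (on_line x) j = (x $ i - x $ j) *\<^sub>R axis 1 1"
    by (simp add: scaleR_left_diff_distrib)
  then show ?thesis
    by (simp add: r_def dist_norm)
qed

text \<open>The quotient (x_i - x_j) / (x_i - x_j)^2 is left uncancelled, so that the right-hand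
  side is the sum in \<open>A_mat_on_line_mult\<close> taken at the positions.\<close>

lemma collinear_relative_equilibriumD:
  fixes x :: "real ^ 4"
  assumes "relative_equilibrium \<Gamma> \<omega> (on_line x)"
  defines "c \<equiv> (\<Sum>i\<in>UNIV. \<Gamma> $ i * x $ i) / total_circ \<Gamma>"
  shows "total_circ \<Gamma> \<noteq> 0" "\<omega> \<noteq> 0" "i \<noteq> j \<Longrightarrow> x $ i \<noteq> x $ j"
    "\<omega> * (x $ i - c) = (\<Sum>j\<in>UNIV - {i}. \<Gamma> $ j * (x $ i - x $ j) / (x $ i - x $ j)\<^sup>2)"
    "center \<Gamma> (on_line x) $ 1 = c" "center \<Gamma> (on_line x) $ 2 = 0"
proof -
  have v: "vortex (on_line x) i $ 1 = x $ i" "vortex (on_line x) i $ 2 = 0" for i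
    by (simp_all add: vortex_def on_line_def)
  show "total_circ \<Gamma> \<noteq> 0" "\<omega> \<noteq> 0"
    using assms by (simp_all add: relative_equilibrium_def)
  show ne: "x $ i \<noteq> x $ j" if "i \<noteq> j" for i j
  proof
    assume "x $ i = x $ j"
    then have "vortex (on_line x) i = vortex (on_line x) j"
      by (simp add: vec_eq_iff forall_2 v)
    with assms that show False
      by (auto simp: relative_equilibrium_def dest: injD)
  qed
  show c: "center \<Gamma> (on_line x) $ 1 = c" "center \<Gamma> (on_line x) $ 2 = 0"
    by (simp_all add: center_def c_def v)
  have "- \<omega> *\<^sub>R (vortex (on_line x) i - center \<Gamma> (on_line x)) =
      (\<Sum>j\<in>UNIV - {i}. (\<Gamma> $ j / (r (on_line x) i j)\<^sup>2) *\<^sub>R (vortex (on_line x) j - vortex (on_line x) i))"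
    using assms by (simp add: relative_equilibrium_def)
  then have "- \<omega> * (x $ i - c) = (\<Sum>j\<in>UNIV - {i}. (\<Gamma> $ j / (x $ i - x $ j)\<^sup>2) * (x $ j - x $ i))"
    by (simp add: vec_eq_iff forall_2 v c r_on_line)
  then have "\<omega> * (x $ i - c) = - (\<Sum>j\<in>UNIV - {i}. (\<Gamma> $ j / (x $ i - x $ j)\<^sup>2) * (x $ j - x $ i))"
    by linarith
  also have "\<dots> = (\<Sum>j\<in>UNIV - {i}. \<Gamma> $ j * (x $ i - x $ j) / (x $ i - x $ j)\<^sup>2)"
    unfolding sum_negf[symmetric] by (intro sum.cong) (auto simp: algebra_simps diff_divide_distrib)
  finally show "\<omega> * (x $ i - c) = (\<Sum>j\<in>UNIV - {i}. \<Gamma> $ j * (x $ i - x $ j) / (x $ i - x $ j)\<^sup>2)" .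
qed

text \<open>Each row of \<open>A\<close> sums to 0, so \<open>A\<close> acts on \<open>y\<close>
  through differences only, as a weighted graph Laplacian.\<close>

lemma A_mat_on_line_mult:
  "(A_mat \<Gamma> \<omega> (on_line x) *v y) $ i =
     inverse \<omega> * (\<Sum>j\<in>UNIV - {i}. \<Gamma> $ j * (y $ i - y $ j) / (x $ i - x $ j)\<^sup>2)"
proof -
  have "(A_mat \<Gamma> \<omega> (on_line x) *v y) $ i =
     A_mat \<Gamma> \<omega> (on_line x) $ i $ i * y $ i + (\<Sum>j\<in>UNIV - {i}. A_mat \<Gamma> \<omega> (on_line x) $ i $ j * y $ j)"
    unfolding matrix_vector_mult_def by (simp add: sum.remove[of _ i])
  also have "\<dots> = inverse \<omega> * (\<Sum>j\<in>UNIV - {i}. \<Gamma> $ j / (x $ i - x $ j)\<^sup>2) * y $ i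
      + (\<Sum>j\<in>UNIV - {i}. - inverse \<omega> * \<Gamma> $ j / (x $ i - x $ j)\<^sup>2 * y $ j)"
    by (simp add: A_mat_def r_on_line sum_distrib_left sum_negf divide_inverse mult.assoc)
  also have "\<dots> = inverse \<omega> * (\<Sum>j\<in>UNIV - {i}. \<Gamma> $ j * (y $ i - y $ j) / (x $ i - x $ j)\<^sup>2)"
    unfolding sum_distrib_left sum_distrib_right sum.distrib[symmetric]
    by (intro sum.cong) (auto simp: algebra_simps diff_divide_distrib)
  finally show ?thesis .
qed

lemma A_mat_eigenvector_0: "A_mat \<Gamma> \<omega> (on_line x) *v 1 = 0"
  by (simp add: vec_eq_iff A_mat_on_line_mult)

lemma A_mat_eigenvector_1:
  assumes "relative_equilibrium \<Gamma> \<omega> (on_line x)"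
  defines "y \<equiv> \<chi> i. x $ i - center \<Gamma> (on_line x) $ 1"
  shows "A_mat \<Gamma> \<omega> (on_line x) *v y = y"
proof -
  note re = collinear_relative_equilibriumD[OF assms(1)]
  show ?thesis
    using re(2)
    by (simp add: vec_eq_iff A_mat_on_line_mult y_def re(5) re(4)[symmetric])
qed

text \<open>Let \<open>e1\<close>, ..., \<open>e4\<close> be the elementary symmetric functions of
  the eigenvalues. The first two are computed: \<open>e1\<close> = 1 + T is the trace and
  \<open>e2\<close> = D + T the sum of the principal minors of size 2. The known roots 0 and 1 then
  force \<open>e4\<close> = 0 and \<open>e3\<close> = 1 - \<open>e1\<close> + \<open>e2\<close> = D,
  so no larger minor is expanded.\<close>

lemma charpoly_A_mat:
  assumes re: "relative_equilibrium \<Gamma> \<omega> (on_line x)"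
  defines "T \<equiv> T_coeff \<Gamma> \<omega> (on_line x)" and "D \<equiv> D_coeff \<Gamma> \<omega> (on_line x)"
  shows "charpoly (A_mat \<Gamma> \<omega> (on_line x)) =
     [:0, 1:] * [:-1, 1:] * [:complex_of_real D, - complex_of_real T, 1:]"
proof -
  define A where "A = A_mat \<Gamma> \<omega> (on_line x)"
  define s where "s i j = 1 / (r (on_line x) i j)\<^sup>2" for i j
  have s_sym: "s j i = s i j" for i j
    by (simp add: s_def r_def dist_commute)
  define t where "t = inverse \<omega>"
  have A: "A $ i $ j = - (t * \<Gamma> $ j * s i j)" if "i \<noteq> j" for i j
    using that by (simp add: A_def A_mat_def t_def s_def)
  have Aii: "A $ i $ i = (\<Sum>j\<in>UNIV - {i}. t * \<Gamma> $ j * s i j)" for i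
    by (simp add: A_def A_mat_def t_def s_def sum_negf)
  note ent = Aii[of 1] Aii[of 2] Aii[of 3] Aii[of 4]
  define e1 where "e1 = A$1$1 + A$2$2 + A$3$3 + A$4$4"
  define m2 where "m2 i j = A$i$i * A$j$j - A$i$j * A$j$i" for i j
  define e2 where "e2 = m2 1 2 + m2 1 3 + m2 1 4 + m2 2 3 + m2 2 4 + m2 3 4"
  note sym = s_sym[of 1 2] s_sym[of 1 3] s_sym[of 1 4] s_sym[of 2 3] s_sym[of 2 4] s_sym[of 3 4]
  have e1: "e1 = 1 + T"
  proof -
    have "T = t * (\<Sum>(i, j)\<in>{(i, j). i < j}. (\<Gamma> $ i + \<Gamma> $ j) * s i j) - 1"
      by (simp add: T_def T_coeff_def t_def s_def)
    then show ?thesis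
      unfolding sum_pairs_4 e1_def
      by (simp add: ent sum_diff1 sum_4 sym algebra_simps)
  qed
  \<comment> \<open>In each minor \<open>m2 i j\<close> the square of \<open>s i j\<close> cancels.
    Collecting the remaining products of two different \<open>s\<close> gives
    \<open>t\<^sup>2\<close> times \<delta>, which is D + T by the definition of D.\<close>
  have e2: "e2 = D + T"
  proof -
    \<comment> \<open>With the condition on \<open>i\<close> moved into the summand,
      \<open>sum_pairs_4\<close> applies to the inner sums of \<delta>.\<close>
    have sumP: "(\<Sum>(j, k)\<in>{(j, k). j < k \<and> j \<noteq> i \<and> k \<noteq> i}. f j k) =
        (\<Sum>(j, k)\<in>{(j, k). j < k}. if j \<noteq> i \<and> k \<noteq> i then f j k else 0)"
      for f :: "4 \<Rightarrow> 4 \<Rightarrow> real" and i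
      by (rule sum.mono_neutral_cong_left) auto
    have "\<delta> \<Gamma> (on_line x) =
     (\<Gamma>$1 + \<Gamma>$2) * (\<Gamma>$3 + \<Gamma>$4) * (s 1 2 * s 3 4)
   + (\<Gamma>$1 + \<Gamma>$3) * (\<Gamma>$2 + \<Gamma>$4) * (s 1 3 * s 2 4)
   + (\<Gamma>$1 + \<Gamma>$4) * (\<Gamma>$2 + \<Gamma>$3) * (s 1 4 * s 2 3)
   + (\<Sum>i\<in>UNIV. \<Sum>(j, k)\<in>{(j, k). j < k \<and> j \<noteq> i \<and> k \<noteq> i}.
        \<Gamma>$i * (\<Gamma>$i + \<Gamma>$j + \<Gamma>$k) * (s i j * s i k))"
      by (simp add: \<delta>_def s_def)
    also have "\<dots> = (\<Gamma>$1 + \<Gamma>$2) * (\<Gamma>$3 + \<Gamma>$4) * (s 1 2 * s 3 4)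
   + (\<Gamma>$1 + \<Gamma>$3) * (\<Gamma>$2 + \<Gamma>$4) * (s 1 3 * s 2 4)
   + (\<Gamma>$1 + \<Gamma>$4) * (\<Gamma>$2 + \<Gamma>$3) * (s 1 4 * s 2 3)
   + (\<Gamma>$1 * (\<Gamma>$1 + \<Gamma>$2 + \<Gamma>$3) * (s 1 2 * s 1 3)
    + \<Gamma>$1 * (\<Gamma>$1 + \<Gamma>$2 + \<Gamma>$4) * (s 1 2 * s 1 4)
    + \<Gamma>$1 * (\<Gamma>$1 + \<Gamma>$3 + \<Gamma>$4) * (s 1 3 * s 1 4)
    + \<Gamma>$2 * (\<Gamma>$2 + \<Gamma>$1 + \<Gamma>$3) * (s 1 2 * s 2 3)
    + \<Gamma>$2 * (\<Gamma>$2 + \<Gamma>$1 + \<Gamma>$4) * (s 1 2 * s 2 4)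
    + \<Gamma>$2 * (\<Gamma>$2 + \<Gamma>$3 + \<Gamma>$4) * (s 2 3 * s 2 4)
    + \<Gamma>$3 * (\<Gamma>$3 + \<Gamma>$1 + \<Gamma>$2) * (s 1 3 * s 2 3)
    + \<Gamma>$3 * (\<Gamma>$3 + \<Gamma>$1 + \<Gamma>$4) * (s 1 3 * s 3 4)
    + \<Gamma>$3 * (\<Gamma>$3 + \<Gamma>$2 + \<Gamma>$4) * (s 2 3 * s 3 4)
    + \<Gamma>$4 * (\<Gamma>$4 + \<Gamma>$1 + \<Gamma>$2) * (s 1 4 * s 2 4)
    + \<Gamma>$4 * (\<Gamma>$4 + \<Gamma>$1 + \<Gamma>$3) * (s 1 4 * s 3 4)
    + \<Gamma>$4 * (\<Gamma>$4 + \<Gamma>$2 + \<Gamma>$3) * (s 2 4 * s 3 4))"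
      unfolding sumP sum_4 sum_pairs_4 by (simp add: sym ac_simps)
    finally have "\<delta> \<Gamma> (on_line x) = \<dots>" .
    moreover have "D + T = t\<^sup>2 * \<delta> \<Gamma> (on_line x)"
      by (simp add: D_def D_coeff_def T_def t_def)
    ultimately show ?thesis
      unfolding e2_def m2_def
      by (simp add: ent A sum_diff1 sum_4 sym algebra_simps power2_eq_square)
  qed
  obtain e3 e4 where cp: "charpoly A = map_poly complex_of_real [:e4, - e3, e2, - e1, 1:]"
    using charpoly_4[of A] unfolding e1_def e2_def m2_def by blast
  have "(1 :: real ^ 4) \<noteq> 0"
    by (simp add: vec_eq_iff)
  then have "poly (charpoly A) (complex_of_real 0) = 0"
    using eigenvector_imp_root_charpoly[of A 1 0] A_mat_eigenvector_0[of \<Gamma> \<omega> x] by (simp add: A_def)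
  then have e4: "e4 = 0"
    by (simp add: cp map_poly_pCons)
  define y :: "real ^ 4" where "y = (\<chi> i. x $ i - center \<Gamma> (on_line x) $ 1)"
  have "y $ 1 \<noteq> y $ 2"
    using collinear_relative_equilibriumD(3)[OF re, of 1 2] by (simp add: y_def)
  then have "y \<noteq> 0"
    by auto
  then have "poly (charpoly A) (complex_of_real 1) = 0"
    using eigenvector_imp_root_charpoly[of A y 1] A_mat_eigenvector_1[OF re] by (simp add: A_def y_def)
  then have "complex_of_real (1 - e1 + e2 - e3 + e4) = 0"
    unfolding cp by (simp add: map_poly_pCons algebra_simps)
  then have "1 - e1 + e2 - e3 + e4 = 0"
    by (simp only: of_real_eq_0_iff)
  then have e3: "e3 = D"
    using e1 e2 e4 by simp
  show ?thesis
    unfolding A_def[symmetric] cp e1 e2 e3 e4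
    by (simp add: map_poly_pCons)
qed

lemma nontrivial_eigenvals_A_eq:
  assumes "relative_equilibrium \<Gamma> \<omega> (on_line x)"
  shows "nontrivial_eigenvals_A \<Gamma> \<omega> (on_line x) =
    proots [:complex_of_real (D_coeff \<Gamma> \<omega> (on_line x)), - complex_of_real (T_coeff \<Gamma> \<omega> (on_line x)), 1:]"
proof -
  have [simp]: "proots [:0, 1 :: complex:] = {#0#}" "proots [:-1, 1 :: complex:] = {#1#}"
    using proots_linear_factor[of "0 :: complex"] proots_linear_factor[of "-1 :: complex"] by simp_all
  show ?thesis
    unfolding nontrivial_eigenvals_A_def eigenvals_def charpoly_A_mat[OF assms]
    by (subst proots_mult, simp, simp, subst proots_mult) simp_all
qed

subsection \<open>Three equal vortices\<close>

text \<open>These are the equations of motion on a line with the center of vorticity at 0: unit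
  vortices at \<open>a\<close>, \<open>b\<close>, \<open>c\<close>, and the vortex of circulation
  \<open>m\<close> at \<open>d\<close>. With positions as separate arguments, relabeling equal
  vortices just permutes \<open>a\<close>, \<open>b\<close>, \<open>c\<close>.\<close>

definition collinear_three_one :: "real \<Rightarrow> real \<Rightarrow> real \<Rightarrow> real \<Rightarrow> real \<Rightarrow> real \<Rightarrow> bool" where
  "collinear_three_one m \<omega> a b c d \<longleftrightarrow>
     \<omega> \<noteq> 0 \<and> a \<noteq> b \<and> a \<noteq> c \<and> b \<noteq> c \<and> a \<noteq> d \<and> b \<noteq> d \<and> c \<noteq> d \<and>
     a + b + c + m * d = 0 \<and>
     \<omega> * a = 1 / (a - b) + 1 / (a - c) + m / (a - d) \<and>
     \<omega> * b = 1 / (b - a) + 1 / (b - c) + m / (b - d) \<and>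
     \<omega> * c = 1 / (c - a) + 1 / (c - b) + m / (c - d) \<and>
     \<omega> * d = 1 / (d - a) + 1 / (d - b) + 1 / (d - c)"

lemma collinear_three_one_swap12:
  "collinear_three_one m \<omega> a b c d \<Longrightarrow> collinear_three_one m \<omega> b a c d"
  unfolding collinear_three_one_def by (simp add: ac_simps)

lemma collinear_three_one_swap23:
  "collinear_three_one m \<omega> a b c d \<Longrightarrow> collinear_three_one m \<omega> a c b d"
  unfolding collinear_three_one_def by (simp add: ac_simps)

lemma collinear_three_one_reflect:
  assumes "collinear_three_one m \<omega> a b c d"
  shows "collinear_three_one m \<omega> (-a) (-b) (-c) (-d)"
proof -
  have neg: "k / (- u - - v) = - (k / (u - v))" for k u v :: real
    by (metis minus_diff_minus minus_divide_right)
  show ?thesis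
    using assms unfolding collinear_three_one_def neg by simp
qed

section \<open>Pair equations and restrictions on the signs of 1 + m and \<omega>\<close>

text \<open>In the difference of the equations of \<open>b\<close> and \<open>a\<close> every term
  contains the factor \<open>b - a\<close>, which is cancelled. This expresses \<omega> by terms
  whose signs are determined by the ordering and by \<open>m\<close>.\<close>

lemma equal_pair_equation:
  assumes "collinear_three_one m \<omega> a b c d"
  shows "\<omega> = 2 / (b - a)\<^sup>2 - 1 / ((b - c) * (a - c)) - m / ((b - d) * (a - d))"
proof -
  have ne: "b - a \<noteq> 0" "a - b \<noteq> 0" "b - c \<noteq> 0" "a - c \<noteq> 0" "b - d \<noteq> 0" "a - d \<noteq> 0"
    using assms by (auto simp: collinear_three_one_def)
  have "\<omega> * (b - a) = 1 / (b - a) + 1 / (b - c) + m / (b - d) - (1 / (a - b) + 1 / (a - c) + m / (a - d))"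
    using assms unfolding collinear_three_one_def by (simp add: right_diff_distrib)
  also have "\<dots> = (1 / (b - a) - 1 / (a - b)) + (1 / (b - c) - 1 / (a - c)) + m * (1 / (b - d) - 1 / (a - d))"
    by (simp add: algebra_simps)
  also have "1 / (b - a) - 1 / (a - b) = (b - a) * (2 / (b - a)\<^sup>2)"
    using ne by (simp add: divide_simps power2_eq_square) (simp add: algebra_simps)
  also have "1 / (b - c) - 1 / (a - c) = (b - a) * (- 1 / ((b - c) * (a - c)))"
    using ne by (simp add: divide_simps)
  also have "1 / (b - d) - 1 / (a - d) = (b - a) * (- 1 / ((b - d) * (a - d)))"
    using ne by (simp add: divide_simps)
  finally have "\<omega> * (b - a) =
      (2 / (b - a)\<^sup>2 - 1 / ((b - c) * (a - c)) - m / ((b - d) * (a - d))) * (b - a)"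
    by (simp add: algebra_simps)
  then show ?thesis
    using ne(1) by simp
qed

text \<open>The same elimination for circulations 1 and \<open>m\<close>; the mutual interaction now
  carries the factor 1 + m, which is why m = -1 is the critical value.\<close>

lemma mixed_pair_equation:
  assumes "collinear_three_one m \<omega> a b c d"
  shows "\<omega> = (1 + m) / (d - c)\<^sup>2 - 1 / ((d - a) * (c - a)) - 1 / ((d - b) * (c - b))"
proof -
  have ne: "d - c \<noteq> 0" "c - d \<noteq> 0" "d - a \<noteq> 0" "c - a \<noteq> 0" "d - b \<noteq> 0" "c - b \<noteq> 0"
    using assms by (auto simp: collinear_three_one_def)
  have "\<omega> * (d - c) = 1 / (d - a) + 1 / (d - b) + 1 / (d - c) - (1 / (c - a) + 1 / (c - b) + m / (c - d))"
    using assms unfolding collinear_three_one_def by (simp add: right_diff_distrib)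
  also have "\<dots> = (1 / (d - c) - m / (c - d)) + (1 / (d - a) - 1 / (c - a)) + (1 / (d - b) - 1 / (c - b))"
    by (simp add: algebra_simps)
  also have "1 / (d - c) - m / (c - d) = (d - c) * ((1 + m) / (d - c)\<^sup>2)"
    using ne by (simp add: divide_simps power2_eq_square) (simp add: algebra_simps)
  also have "1 / (d - a) - 1 / (c - a) = (d - c) * (- 1 / ((d - a) * (c - a)))"
    using ne by (simp add: divide_simps)
  also have "1 / (d - b) - 1 / (c - b) = (d - c) * (- 1 / ((d - b) * (c - b)))"
    using ne by (simp add: divide_simps)
  finally have "\<omega> * (d - c) =
      ((1 + m) / (d - c)\<^sup>2 - 1 / ((d - a) * (c - a)) - 1 / ((d - b) * (c - b))) * (d - c)"
    by (simp add: algebra_simps)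
  then show ?thesis
    using ne(1) by simp
qed

text \<open>If m < -1, all three terms of the equation for the pair \<open>c\<close>,
  \<open>d\<close> are negative, so \<omega> < 0. But the closer of the two neighbouring pairs of
  equal vortices gives \<omega> > 0: the term of the third equal vortex is at most half of 2 /
  gap^2, and the term with \<open>m\<close> is positive.\<close>

lemma no_end_equilibrium_ordered:
  assumes eq: "collinear_three_one m \<omega> a b c d" and ord: "a < b" "b < c" "c < d"
  shows "m \<ge> -1"
proof (rule ccontr)
  assume "\<not> m \<ge> -1"
  then have m: "m < -1" by simp
  have "\<omega> = (1 + m) / (d - c)\<^sup>2 - 1 / ((d - a) * (c - a)) - 1 / ((d - b) * (c - b))"
    by (rule mixed_pair_equation[OF eq])
  moreover have "(1 + m) / (d - c)\<^sup>2 < 0" "1 / ((d - a) * (c - a)) > 0" "1 / ((d - b) * (c - b)) > 0"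
    using m ord by (simp_all add: divide_neg_pos)
  ultimately have neg: "\<omega> < 0" by linarith
  have bc: "\<omega> = 2 / (c - b)\<^sup>2 - 1 / ((c - a) * (b - a)) - m / ((c - d) * (b - d))"
    by (rule equal_pair_equation[OF collinear_three_one_swap23[OF collinear_three_one_swap12[OF eq]]])
  have ab: "\<omega> = 2 / (b - a)\<^sup>2 - 1 / ((b - c) * (a - c)) - m / ((b - d) * (a - d))"
    by (rule equal_pair_equation[OF eq])
  have pos: "m / ((c - d) * (b - d)) < 0" "m / ((b - d) * (a - d)) < 0"
    using m ord by (auto intro!: divide_neg_pos mult_neg_neg)
  show False
  proof (cases "c - b \<le> b - a")
    case True
    have "(c - b) * (c - b) \<le> (c - a) * (b - a)"
      using True ord by (intro mult_mono) auto
    then have "1 / ((c - a) * (b - a)) \<le> 1 / (c - b)\<^sup>2"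
      using ord by (intro divide_left_mono) (auto simp: power2_eq_square)
    moreover have "2 / (c - b)\<^sup>2 = 2 * (1 / (c - b)\<^sup>2)" "1 / (c - b)\<^sup>2 > 0"
      using ord by auto
    ultimately show False
      using neg bc pos by linarith
  next
    case False
    have "(b - a) * (b - a) \<le> (c - b) * (c - a)"
      using False ord by (intro mult_mono) auto
    then have "1 / ((c - b) * (c - a)) \<le> 1 / (b - a)\<^sup>2"
      using ord by (intro divide_left_mono) (auto simp: power2_eq_square)
    moreover have "1 / ((b - c) * (a - c)) = 1 / ((c - b) * (c - a))"
      by (simp add: algebra_simps)
    moreover have "2 / (b - a)\<^sup>2 = 2 * (1 / (b - a)\<^sup>2)" "1 / (b - a)\<^sup>2 > 0"
      using ord by auto
    ultimately show False
      using neg ab pos by linarith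
  qed
qed

text \<open>The first identity is the center condition. The second and third add up the equations of
  the equal vortices with factors \<alpha>, \<beta>, \<gamma> and their squares, which turns the
  pair interactions into polynomials by \<open>p1\<close> and \<open>p2\<close>. The fourth clears
  denominators in the equation of \<open>d\<close>. All are symmetric in the equal vortices, hence
  speak about the coefficients of a single cubic.\<close>

lemma collinear_three_one_symmetric_identities:
  assumes eq: "collinear_three_one m \<omega> a b c d"
  defines "\<alpha> \<equiv> a - d" and "\<beta> \<equiv> b - d" and "\<gamma> \<equiv> c - d"
  shows "\<alpha> + \<beta> + \<gamma> = - (3 + m) * d"
    "\<omega> * (\<alpha> * \<alpha> + \<beta> * \<beta> + \<gamma> * \<gamma> + d * (\<alpha> + \<beta> + \<gamma>)) = 3 + 3 * m"
    "\<omega> * (\<alpha> * \<alpha> * (\<alpha> + d) + \<beta> * \<beta> * (\<beta> + d) + \<gamma> * \<gamma> * (\<gamma> + d)) = (2 + m) * (\<alpha> + \<beta> + \<gamma>)"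
    "\<omega> * d * (\<alpha> * \<beta> * \<gamma>) = - (\<alpha> * \<beta> + \<alpha> * \<gamma> + \<beta> * \<gamma>)"
proof -
  have ne: "\<alpha> \<noteq> 0" "\<beta> \<noteq> 0" "\<gamma> \<noteq> 0" "\<alpha> \<noteq> \<beta>" "\<alpha> \<noteq> \<gamma>" "\<beta> \<noteq> \<gamma>"
    using eq by (auto simp: collinear_three_one_def \<alpha>_def \<beta>_def \<gamma>_def)
  have abc: "a = \<alpha> + d" "b = \<beta> + d" "c = \<gamma> + d"
    by (simp_all add: \<alpha>_def \<beta>_def \<gamma>_def)
  have e: "\<omega> * (\<alpha> + d) = 1 / (\<alpha> - \<beta>) + 1 / (\<alpha> - \<gamma>) + m / \<alpha>"
    "\<omega> * (\<beta> + d) = 1 / (\<beta> - \<alpha>) + 1 / (\<beta> - \<gamma>) + m / \<beta>"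
    "\<omega> * (\<gamma> + d) = 1 / (\<gamma> - \<alpha>) + 1 / (\<gamma> - \<beta>) + m / \<gamma>"
    "\<omega> * d = - 1 / \<alpha> - 1 / \<beta> - 1 / \<gamma>"
    and center: "\<alpha> + \<beta> + \<gamma> + 3 * d + m * d = 0"
    using eq by (simp_all add: collinear_three_one_def abc)
  show "\<alpha> + \<beta> + \<gamma> = - (3 + m) * d"
    using center by (simp add: algebra_simps)
  have p1: "u / (u - v) + v / (v - u) = 1" if "u \<noteq> v" for u v :: real
    using that by (simp add: divide_simps) (simp add: algebra_simps)
  have p2: "u * u / (u - v) + v * v / (v - u) = u + v" if "u \<noteq> v" for u v :: real
    using that by (simp add: divide_simps) (simp add: algebra_simps)
  have "\<omega> * (\<alpha> * \<alpha> + \<beta> * \<beta> + \<gamma> * \<gamma> + d * (\<alpha> + \<beta> + \<gamma>)) =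
      \<alpha> * (\<omega> * (\<alpha> + d)) + \<beta> * (\<omega> * (\<beta> + d)) + \<gamma> * (\<omega> * (\<gamma> + d))"
    by (simp add: algebra_simps)
  also have "\<dots> = (\<alpha> / (\<alpha> - \<beta>) + \<beta> / (\<beta> - \<alpha>)) + (\<alpha> / (\<alpha> - \<gamma>) + \<gamma> / (\<gamma> - \<alpha>))
      + (\<beta> / (\<beta> - \<gamma>) + \<gamma> / (\<gamma> - \<beta>)) + 3 * m"
    unfolding e(1-3) using ne by (simp add: distrib_left)
  finally show "\<omega> * (\<alpha> * \<alpha> + \<beta> * \<beta> + \<gamma> * \<gamma> + d * (\<alpha> + \<beta> + \<gamma>)) = 3 + 3 * m"
    using ne by (simp add: p1)
  have "\<omega> * (\<alpha> * \<alpha> * (\<alpha> + d) + \<beta> * \<beta> * (\<beta> + d) + \<gamma> * \<gamma> * (\<gamma> + d)) =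
      \<alpha> * \<alpha> * (\<omega> * (\<alpha> + d)) + \<beta> * \<beta> * (\<omega> * (\<beta> + d)) + \<gamma> * \<gamma> * (\<omega> * (\<gamma> + d))"
    by (simp add: algebra_simps)
  also have "\<dots> = (\<alpha> * \<alpha> / (\<alpha> - \<beta>) + \<beta> * \<beta> / (\<beta> - \<alpha>)) + (\<alpha> * \<alpha> / (\<alpha> - \<gamma>) + \<gamma> * \<gamma> / (\<gamma> - \<alpha>))
      + (\<beta> * \<beta> / (\<beta> - \<gamma>) + \<gamma> * \<gamma> / (\<gamma> - \<beta>)) + m * (\<alpha> + \<beta> + \<gamma>)"
    unfolding e(1-3) using ne by (simp add: distrib_left)
  also have "\<dots> = (2 + m) * (\<alpha> + \<beta> + \<gamma>)"
    using ne by (simp add: p2 algebra_simps)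
  finally show "\<omega> * (\<alpha> * \<alpha> * (\<alpha> + d) + \<beta> * \<beta> * (\<beta> + d) + \<gamma> * \<gamma> * (\<gamma> + d)) = (2 + m) * (\<alpha> + \<beta> + \<gamma>)" .
  show "\<omega> * d * (\<alpha> * \<beta> * \<gamma>) = - (\<alpha> * \<beta> + \<alpha> * \<gamma> + \<beta> * \<gamma>)"
    unfolding e(4) using ne by (simp add: field_simps)
qed

lemma inner_equilibrium_ordered:
  assumes eq: "collinear_three_one m \<omega> a b c d" and ord: "a < d" "d < b" "b < c" and m: "m \<noteq> -1"
  shows "m > -1/2 \<and> \<omega> > 0"
proof -
  have bd: "\<omega> = (1 + m) / (d - b)\<^sup>2 - 1 / ((d - a) * (b - a)) - 1 / ((d - c) * (b - c))"
    by (rule mixed_pair_equation[OF collinear_three_one_swap23[OF eq]])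
  have bc: "\<omega> = 2 / (c - b)\<^sup>2 - 1 / ((c - a) * (b - a)) - m / ((c - d) * (b - d))"
    by (rule equal_pair_equation[OF collinear_three_one_swap23[OF collinear_three_one_swap12[OF eq]]])
  have ab: "\<omega> = 2 / (b - a)\<^sup>2 - 1 / ((b - c) * (a - c)) - m / ((b - d) * (a - d))"
    by (rule equal_pair_equation[OF eq])
  \<comment> \<open>For m < -1 the equation of the pair \<open>b\<close>, \<open>c\<close> would
    give a strictly larger \<omega> than that of the pair \<open>b\<close>,
    \<open>d\<close>.\<close>
  have m1: "m > -1"
  proof (rule ccontr)
    assume "\<not> m > -1"
    then have m1: "m < -1" using m by simp
    have "(d - a) * (b - a) < (c - a) * (b - a)"
      using ord by simp
    then have "1 / ((c - a) * (b - a)) < 1 / ((d - a) * (b - a))"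
      using ord by (intro divide_strict_left_mono) auto
    moreover have "(1 + m) / (d - b)\<^sup>2 < 0" "1 / ((d - c) * (b - c)) > 0" "2 / (c - b)\<^sup>2 > 0"
        "m / ((c - d) * (b - d)) < 0"
      using m1 ord by (auto simp: divide_less_0_iff zero_less_divide_iff zero_less_mult_iff mult_less_0_iff)
    ultimately show False
      using bc bd by linarith
  qed
  define \<alpha> \<beta> \<gamma> where "\<alpha> = d - a" and "\<beta> = b - d" and "\<gamma> = c - d"
  have pos: "\<alpha> > 0" "\<beta> > 0" "\<gamma> > \<beta>"
    using ord by (simp_all add: \<alpha>_def \<beta>_def \<gamma>_def)
  \<comment> \<open>By the center condition, \<open>S\<close> is the moment of inertia about the
    center, weighted by circulations. Eliminating \<open>d\<close> turns (3 + m) S into a quadratic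
    form in the distances; it is positive because \<open>a\<close> and the pair \<open>b\<close>,
    \<open>c\<close> lie on opposite sides of \<open>d\<close>.\<close>
  define S where "S = \<alpha> * \<alpha> + \<beta> * \<beta> + \<gamma> * \<gamma> + d * (\<beta> + \<gamma> - \<alpha>)"
  have sum: "\<beta> + \<gamma> - \<alpha> = - (3 + m) * d" and S: "\<omega> * S = 3 + 3 * m"
    using collinear_three_one_symmetric_identities(1,2)[OF eq]
    by (simp_all add: \<alpha>_def \<beta>_def \<gamma>_def S_def algebra_simps)
  have "(3 + m) * S = (3 + m) * (\<alpha> * \<alpha> + \<beta> * \<beta> + \<gamma> * \<gamma>) + ((3 + m) * d) * (\<beta> + \<gamma> - \<alpha>)"
    by (simp add: S_def algebra_simps)
  also have "(3 + m) * d = - (\<beta> + \<gamma> - \<alpha>)"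
    using sum by (simp only: mult_minus_left minus_minus)
  finally have "(3 + m) * S = (1 + m) * (\<alpha> * \<alpha> + \<beta> * \<beta> + \<gamma> * \<gamma>)
      + (\<alpha> * \<alpha> + (\<gamma> - \<beta>) * (\<gamma> - \<beta>) + 2 * (\<alpha> * \<beta>) + 2 * (\<alpha> * \<gamma>))"
    by (simp add: algebra_simps)
  moreover have "(1 + m) * (\<alpha> * \<alpha> + \<beta> * \<beta> + \<gamma> * \<gamma>) \<ge> 0"
    using m1 by simp
  moreover have "\<alpha> * \<alpha> > 0" "(\<gamma> - \<beta>) * (\<gamma> - \<beta>) > 0" "\<alpha> * \<beta> > 0" "\<alpha> * \<gamma> > 0"
    using pos by simp_all
  ultimately have "(3 + m) * S > 0" by linarith
  then have "S > 0"
    using m1 by (simp add: zero_less_mult_iff)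
  moreover have "\<omega> * S > 0"
    using S m1 by simp
  ultimately have w: "\<omega> > 0"
    by (simp add: zero_less_mult_iff)
  \<comment> \<open>Consider the equal vortices \<open>a\<close> and \<open>b\<close> on the two
    sides of \<open>d\<close>. If m <= -1/2, then 4 \<alpha> \<beta> <= (\<alpha> + \<beta>)^2 shows
    that the repulsive main term in their equation is outweighed by the term with \<open>m\<close>,
    so \<omega> < 0.\<close>
  moreover have "m > -1/2"
  proof (rule ccontr)
    assume "\<not> m > -1/2"
    then have m2: "2 * m \<le> -1" by simp
    have "4 * (\<alpha> * \<beta>) \<le> (\<alpha> + \<beta>)\<^sup>2"
      using zero_le_power2[of "\<alpha> - \<beta>"] by (simp add: power2_eq_square algebra_simps)
    moreover have "-2 * m * (\<alpha> + \<beta>)\<^sup>2 \<ge> 1 * (\<alpha> + \<beta>)\<^sup>2"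
      using m2 by (intro mult_right_mono) auto
    ultimately have "2 * (\<alpha> * \<beta>) + m * (\<alpha> + \<beta>)\<^sup>2 \<le> 0"
      by linarith
    then have "2 / (\<alpha> + \<beta>)\<^sup>2 + m / (\<alpha> * \<beta>) \<le> 0"
      using pos by (simp add: field_simps)
    moreover have "(b - d) * (a - d) = - (\<alpha> * \<beta>)" "b - a = \<alpha> + \<beta>"
      by (simp_all add: \<alpha>_def \<beta>_def algebra_simps)
    then have "\<omega> = 2 / (\<alpha> + \<beta>)\<^sup>2 - 1 / ((b - c) * (a - c)) + m / (\<alpha> * \<beta>)"
      using ab by simp
    moreover have "1 / ((b - c) * (a - c)) > 0"
      using ord by (auto intro!: divide_neg_pos mult_neg_neg)
    ultimately show False
      using w by linarith
  qed
  ultimately show ?thesis by simp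
qed

text \<open>Relabeling sorts the equal vortices, and reflecting the line covers the case of a fourth
  vortex at the left end.\<close>

lemma same_side_imp_circulation_ge:
  assumes eq: "collinear_three_one m \<omega> a b c d"
    and side: "a < d \<and> b < d \<and> c < d \<or> d < a \<and> d < b \<and> d < c"
  shows "m \<ge> -1"
proof -
  have left: "m \<ge> -1" if eq: "collinear_three_one m \<omega> a b c d" and lt: "a < d" "b < d" "c < d" for a b c d
  proof -
    have ne: "a \<noteq> b" "a \<noteq> c" "b \<noteq> c"
      using eq by (auto simp: collinear_three_one_def)
    note s12 = collinear_three_one_swap12 and s23 = collinear_three_one_swap23
    note perms = eq s12[OF eq] s23[OF eq] s23[OF s12[OF eq]] s12[OF s23[OF eq]] s12[OF s23[OF s12[OF eq]]]
    consider "a < b" "b < c" | "b < a" "a < c" | "a < c" "c < b" | "b < c" "c < a" | "c < a" "a < b" | "c < b" "b < a"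
      using ne by linarith
    then show ?thesis
      by cases (use perms[THEN no_end_equilibrium_ordered] lt in auto)
  qed
  show ?thesis
    using side left[OF eq] left[OF collinear_three_one_reflect[OF eq]] by auto
qed

text \<open>Up to reflection and relabeling, an inner fourth vortex has exactly one equal vortex to
  its left, which is the ordering of \<open>inner_equilibrium_ordered\<close>.\<close>

lemma inner_imp_circulation_gt:
  assumes eq: "collinear_three_one m \<omega> a b c d" and m: "m \<noteq> -1"
    and side: "\<not> (a < d \<and> b < d \<and> c < d)" "\<not> (d < a \<and> d < b \<and> d < c)"
  shows "m > -1/2 \<and> \<omega> > 0"
proof -
  have left: "m > -1/2 \<and> \<omega> > 0"
    if eq: "collinear_three_one m \<omega> a b c d" and lt: "a < d" "d < b" "d < c" for a b c d
  proof -
    have "b < c \<or> c < b"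
      using eq by (auto simp: collinear_three_one_def)
    then show ?thesis
      using inner_equilibrium_ordered[OF eq lt(1,2)]
        inner_equilibrium_ordered[OF collinear_three_one_swap23[OF eq] lt(1,3)] m by auto
  qed
  have two: "m > -1/2 \<and> \<omega> > 0"
    if eq: "collinear_three_one m \<omega> a b c d" and lt: "a < d" "d < b" for a b c d
  proof (cases "d < c")
    case True
    then show ?thesis using left[OF eq] lt by simp
  next
    case False
    then have "c < d"
      using eq by (auto simp: collinear_three_one_def)
    then show ?thesis
      using left[OF collinear_three_one_swap12[OF collinear_three_one_reflect[OF eq]]] lt by simp
  qed
  note s12 = collinear_three_one_swap12 and s23 = collinear_three_one_swap23
  note perms = eq s12[OF eq] s23[OF eq] s23[OF s12[OF eq]] s12[OF s23[OF eq]] s12[OF s23[OF s12[OF eq]]]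
  have ne: "a \<noteq> d" "b \<noteq> d" "c \<noteq> d"
    using eq by (auto simp: collinear_three_one_def)
  consider "a < d" "d < b" | "b < d" "d < a" | "a < d" "d < c" | "b < d" "d < c" | "c < d" "d < a" | "c < d" "d < b"
    using ne side by linarith
  then show ?thesis
    by cases (use perms[THEN two] in auto)
qed


section \<open>The cubic of scaled positions and the quadratic for the scaled angular
  velocity\<close>

text \<open>Measured in units of \<open>d\<close>, the symmetric identities involve only
  \<open>m\<close> and \<open>w\<close>. The scaled positions are the roots of Y^3 + (3 + m) Y^2 + q
  Y + q / w, and the last two identities are both linear in \<open>q\<close> for given
  \<open>w\<close>.\<close>

lemma scaled_equilibrium_identities:
  assumes eq: "collinear_three_one m \<omega> a b c d"
  defines "y1 \<equiv> (a - d) / d" and "y2 \<equiv> (b - d) / d" and "y3 \<equiv> (c - d) / d" and "w \<equiv> \<omega> * d\<^sup>2"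
  defines "q \<equiv> y1 * y2 + y1 * y3 + y2 * y3"
  shows "d \<noteq> 0" "w \<noteq> 0" "y1 + y2 + y3 = - (3 + m)" "w * (y1 * y2 * y3) = - q"
    "2 * (w * q) = w * (3 + m) * (2 + m) - 3 * (1 + m)"
    "(1 + m) * (w * q) = 3 * q + (1 + 2 * m) * (3 + m)"
proof -
  define \<alpha> \<beta> \<gamma> where "\<alpha> = a - d" and "\<beta> = b - d" and "\<gamma> = c - d"
  note id = collinear_three_one_symmetric_identities[OF eq, folded \<alpha>_def \<beta>_def \<gamma>_def]
  have ne: "\<alpha> \<noteq> 0" "\<omega> \<noteq> 0"
    using eq by (auto simp: collinear_three_one_def \<alpha>_def)
  \<comment> \<open>For d = 0 the first two elementary symmetric functions of \<alpha>, \<beta>,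
    \<gamma> vanish, hence also the sum of their squares.\<close>
  show d: "d \<noteq> 0"
  proof
    assume "d = 0"
    then have "\<alpha> + \<beta> + \<gamma> = 0" "\<alpha> * \<beta> + \<alpha> * \<gamma> + \<beta> * \<gamma> = 0"
      using id(1,4) by simp_all
    moreover have "\<alpha>\<^sup>2 + \<beta>\<^sup>2 + \<gamma>\<^sup>2 = (\<alpha> + \<beta> + \<gamma>)\<^sup>2 - 2 * (\<alpha> * \<beta> + \<alpha> * \<gamma> + \<beta> * \<gamma>)"
      by (simp add: power2_eq_square algebra_simps)
    ultimately have "\<alpha>\<^sup>2 + \<beta>\<^sup>2 + \<gamma>\<^sup>2 = 0" by simp
    then have "\<alpha>\<^sup>2 = 0"
      using zero_le_power2[of \<alpha>] zero_le_power2[of \<beta>] zero_le_power2[of \<gamma>] by linarith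
    with ne show False by simp
  qed
  have abc: "\<alpha> = d * y1" "\<beta> = d * y2" "\<gamma> = d * y3"
    using d by (simp_all add: \<alpha>_def \<beta>_def \<gamma>_def y1_def y2_def y3_def)
  show "w \<noteq> 0"
    using d ne by (simp add: w_def)
  have "d * (y1 + y2 + y3) = d * (- (3 + m))"
    using id(1) unfolding abc by (simp add: algebra_simps)
  then show sum: "y1 + y2 + y3 = - (3 + m)"
    by (metis d mult_left_cancel)
  have "d\<^sup>2 * (w * (y1 * y2 * y3)) = d\<^sup>2 * (- q)"
    using id(4) unfolding abc w_def q_def by (simp add: algebra_simps power2_eq_square)
  then show prod: "w * (y1 * y2 * y3) = - q"
    by (metis d mult_left_cancel power_not_zero)
  have "w * (y1 * y1 + y2 * y2 + y3 * y3 + (y1 + y2 + y3)) = 3 + 3 * m"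
    using id(2) unfolding abc w_def by (simp add: algebra_simps power2_eq_square)
  moreover have "y1 * y1 + y2 * y2 + y3 * y3 + (y1 + y2 + y3) =
      (y1 + y2 + y3) * (y1 + y2 + y3) - 2 * q + (y1 + y2 + y3)"
    by (simp add: q_def algebra_simps)
  ultimately have "w * ((y1 + y2 + y3) * (y1 + y2 + y3) - 2 * q + (y1 + y2 + y3)) = 3 + 3 * m"
    by simp
  then have "w * ((- (3 + m)) * (- (3 + m)) - 2 * q + - (3 + m)) = 3 + 3 * m"
    unfolding sum .
  then show two: "2 * (w * q) = w * (3 + m) * (2 + m) - 3 * (1 + m)"
    by (simp add: algebra_simps)
  have "d * (w * (y1 * y1 * (y1 + 1) + y2 * y2 * (y2 + 1) + y3 * y3 * (y3 + 1))) =
      d * ((2 + m) * (y1 + y2 + y3))"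
    using id(3) unfolding abc w_def by (simp add: algebra_simps power2_eq_square)
  then have "w * (y1 * y1 * (y1 + 1) + y2 * y2 * (y2 + 1) + y3 * y3 * (y3 + 1)) = (2 + m) * (y1 + y2 + y3)"
    by (metis d mult_left_cancel)
  \<comment> \<open>Newton's identities rewrite the power sums of degrees 3 and 2 in elementary
    symmetric functions.\<close>
  moreover have "y1 * y1 * (y1 + 1) + y2 * y2 * (y2 + 1) + y3 * y3 * (y3 + 1) =
      (y1 + y2 + y3) * (y1 + y2 + y3) * (y1 + y2 + y3) - 3 * (y1 + y2 + y3) * q + 3 * (y1 * y2 * y3)
      + (y1 + y2 + y3) * (y1 + y2 + y3) - 2 * q"
    by (simp add: q_def algebra_simps)
  ultimately have "w * ((y1 + y2 + y3) * (y1 + y2 + y3) * (y1 + y2 + y3) - 3 * (y1 + y2 + y3) * q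
      + 3 * (y1 * y2 * y3) + (y1 + y2 + y3) * (y1 + y2 + y3) - 2 * q) = (2 + m) * (y1 + y2 + y3)"
    by simp
  then have "3 * (w * (y1 * y2 * y3)) =
      - (2 + m) * (3 + m) + (3 + m) * (w * (3 + m) * (2 + m)) - (7 + 3 * m) * (w * q)"
    unfolding sum by (simp add: algebra_simps)
  also have "w * (3 + m) * (2 + m) = 2 * (w * q) + 3 * (1 + m)"
    using two by simp
  finally show "(1 + m) * (w * q) = 3 * q + (1 + 2 * m) * (3 + m)"
    unfolding prod by (simp add: algebra_simps)
qed

text \<open>This eliminates \<open>q\<close> from the last two scaled identities. The factor (3 +
  m)(2 + m) in \<open>u\<close> is chosen so that u = 2 w q + 3 (1 + m), which keeps the
  coefficients polynomial in \<open>m\<close>.\<close>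

lemma scaled_angular_velocity_quadratic:
  assumes "collinear_three_one m \<omega> a b c d"
  defines "u \<equiv> (3 + m) * (2 + m) * (\<omega> * d\<^sup>2)"
  shows "(1 + m) * (u * u) - (10 * (m * m) + 35 * m + 27) * u + 9 * (1 + m) * (2 + m) * (3 + m) = 0"
proof -
  define w where "w = \<omega> * d\<^sup>2"
  define q where "q = (a - d) / d * ((b - d) / d) + (a - d) / d * ((c - d) / d) + (b - d) / d * ((c - d) / d)"
  note id = scaled_equilibrium_identities(5,6)[OF assms(1), folded w_def q_def]
  have u: "u = 2 * (w * q) + 3 * (1 + m)"
    using id(1) by (simp add: u_def w_def algebra_simps)
  have "2 * (w * ((1 + m) * (w * q))) = 2 * (w * (3 * q + (1 + 2 * m) * (3 + m)))"
    by (simp only: id(2))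
  then have "(1 + m) * w * (2 * (w * q)) = 3 * (2 * (w * q)) + 2 * w * (1 + 2 * m) * (3 + m)"
    by (simp add: algebra_simps)
  then have "(1 + m) * w * (u - 3 * (1 + m)) = 3 * (u - 3 * (1 + m)) + 2 * w * (1 + 2 * m) * (3 + m)"
    using u by simp
  then have "(3 + m) * (2 + m) * ((1 + m) * w * (u - 3 * (1 + m))) =
     (3 + m) * (2 + m) * (3 * (u - 3 * (1 + m)) + 2 * w * (1 + 2 * m) * (3 + m))"
    by simp
  then have "(1 + m) * u * (u - 3 * (1 + m)) =
     (3 + m) * (2 + m) * (3 * (u - 3 * (1 + m))) + 2 * u * (1 + 2 * m) * (3 + m)"
    by (simp add: u_def w_def algebra_simps)
  then show ?thesis
    by (simp add: algebra_simps)
qed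

text \<open>Vieta's formulas without division by \<open>a\<close>; the second evaluates the factored
  quadratic at \<open>t\<close>.\<close>

lemma quadratic_two_roots:
  fixes a b c u v :: real
  assumes "a * (u * u) - b * u + c = 0" "a * (v * v) - b * v + c = 0" "u \<noteq> v"
  shows "a * (u * v) = c" "a * ((u - t) * (v - t)) = a * (t * t) - b * t + c"
proof -
  have "(u - v) * (a * (u + v) - b) = 0"
    using assms(1,2) by (simp add: algebra_simps)
  then have b: "b = a * (u + v)"
    using assms(3) by simp
  then show c: "a * (u * v) = c"
    using assms(1) by (simp add: algebra_simps)
  show "a * ((u - t) * (v - t)) = a * (t * t) - b * t + c"
    using b c by (simp add: algebra_simps)
qed

text \<open>The scaled positions have one sign and sum -(3 + m) < 0, so all are negative; hence q >
  0, their product is negative, and w > 0. Newton's inequality for the elementary symmetric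
  functions then gives w q >= 3 (3 + m), and u = 2 w q + 3 (1 + m).\<close>

lemma same_side_scaled_velocity_bound:
  assumes eq: "collinear_three_one m \<omega> a b c d" and m: "m \<noteq> -1"
    and side: "a < d \<and> b < d \<and> c < d \<or> d < a \<and> d < b \<and> d < c"
  shows "9 * m + 21 \<le> (3 + m) * (2 + m) * (\<omega> * d\<^sup>2)"
proof -
  define y1 y2 y3 w where "y1 = (a - d) / d" and "y2 = (b - d) / d" and "y3 = (c - d) / d"
    and "w = \<omega> * d\<^sup>2"
  define q where "q = y1 * y2 + y1 * y3 + y2 * y3"
  note id = scaled_equilibrium_identities[OF eq, folded y1_def y2_def y3_def w_def, folded q_def]
  have m1: "m > -1"
    using same_side_imp_circulation_ge[OF eq side] m by simp
  have "(y1 > 0 \<and> y2 > 0 \<and> y3 > 0) \<or> (y1 < 0 \<and> y2 < 0 \<and> y3 < 0)"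
    using side id(1) unfolding y1_def y2_def y3_def
    by (cases "d > 0") (auto simp: zero_less_divide_iff divide_less_0_iff)
  then have neg: "y1 < 0" "y2 < 0" "y3 < 0"
    using id(3) m1 by auto
  have "y1 * y2 > 0" "y1 * y3 > 0" "y2 * y3 > 0"
    using neg by (simp_all add: mult_neg_neg)
  then have q: "q > 0" and p3: "y1 * y2 * y3 < 0"
    using neg by (simp_all add: q_def mult_pos_neg)
  have w: "w > 0"
  proof (rule ccontr)
    assume "\<not> w > 0"
    then have "w * (y1 * y2 * y3) \<ge> 0"
      using p3 by (simp add: mult_nonpos_nonpos)
    then show False using id(4) q by simp
  qed
  \<comment> \<open>\<open>Z\<close> is e1 e3, and the sum of squares below proves e2^2 >= 3 e1
    e3.\<close>
  define Z where "Z = (y1 + y2 + y3) * (y1 * y2 * y3)"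
  have "2 * (q * q - 3 * Z) =
      (y1 * y2 - y1 * y3)\<^sup>2 + (y1 * y2 - y2 * y3)\<^sup>2 + (y1 * y3 - y2 * y3)\<^sup>2"
    by (simp add: q_def Z_def power2_eq_square algebra_simps)
  then have "0 \<le> 2 * (q * q - 3 * Z)"
    by simp
  then have "3 * Z \<le> q * q"
    by simp
  then have "w * (q * q) \<ge> w * (3 * Z)"
    using w by (simp only: mult_left_mono less_imp_le)
  also have "w * (3 * Z) = 3 * (3 + m) * (- (w * (y1 * y2 * y3)))"
    unfolding Z_def id(3) by (simp add: algebra_simps)
  also have "\<dots> = 3 * (3 + m) * q"
    unfolding id(4) by simp
  finally have "(w * q) * q \<ge> (3 * (3 + m)) * q"
    by (simp add: algebra_simps)
  then have "w * q \<ge> 3 * (3 + m)"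
    using q by (simp only: mult_le_cancel_right)
  then show ?thesis
    using id(5) unfolding w_def[symmetric] by (simp add: algebra_simps)
qed

text \<open>Since u = 2 w q + 3 (1 + m) and w > 0, the claim is q < 0. For q >= 0 the product of the
  scaled positions is nonpositive, so their cubic is positive at every positive argument. Then all
  roots are negative, and the three equal vortices lie on one side of the fourth.\<close>

lemma inner_scaled_velocity_bound:
  assumes eq: "collinear_three_one m \<omega> a b c d" and m: "m \<noteq> -1"
    and side: "\<not> (a < d \<and> b < d \<and> c < d)" "\<not> (d < a \<and> d < b \<and> d < c)"
  shows "(3 + m) * (2 + m) * (\<omega> * d\<^sup>2) < 3 * (1 + m)"
proof -
  define y1 y2 y3 w where "y1 = (a - d) / d" and "y2 = (b - d) / d" and "y3 = (c - d) / d"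
    and "w = \<omega> * d\<^sup>2"
  define q where "q = y1 * y2 + y1 * y3 + y2 * y3"
  note id = scaled_equilibrium_identities[OF eq, folded y1_def y2_def y3_def w_def, folded q_def]
  have m1: "m > -1/2" and "\<omega> > 0"
    using inner_imp_circulation_gt[OF eq m side] by auto
  then have w: "w > 0"
    using id(1) by (simp add: w_def)
  have ne: "y1 \<noteq> 0" "y2 \<noteq> 0" "y3 \<noteq> 0"
    using eq id(1) by (auto simp: collinear_three_one_def y1_def y2_def y3_def)
  have "q < 0"
  proof (rule ccontr)
    assume "\<not> q < 0"
    then have q: "q \<ge> 0" by simp
    have "w * (y1 * y2 * y3) \<le> 0"
      using q id(4) by simp
    then have p3: "y1 * y2 * y3 \<le> 0"
      using w by (simp add: mult_le_0_iff)
    have neg: "y < 0" if y: "y = y1 \<or> y = y2 \<or> y = y3" for y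
    proof (rule ccontr)
      assume "\<not> y < 0"
      then have pos: "y > 0"
        using ne y by auto
      have "(y - y1) * (y - y2) * (y - y3) = 0"
        using y by auto
      then have "y * y * y + (- (y1 + y2 + y3)) * (y * y) + q * y - y1 * y2 * y3 = 0"
        by (simp add: q_def algebra_simps)
      then have "y * y * y + (3 + m) * (y * y) + q * y - y1 * y2 * y3 = 0"
        by (simp only: id(3) minus_minus)
      moreover have "y * y * y > 0" "(3 + m) * (y * y) > 0" "q * y \<ge> 0"
        using pos q m1 by simp_all
      ultimately show False
        using p3 by linarith
    qed
    have "y1 < 0" "y2 < 0" "y3 < 0"
      using neg by auto
    then have "a < d \<and> b < d \<and> c < d \<or> d < a \<and> d < b \<and> d < c"
      using id(1) unfolding y1_def y2_def y3_def by (cases "d > 0") (auto simp: divide_less_0_iff)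
    with side show False by blast
  qed
  then have "w * q < 0"
    using w by (simp add: mult_pos_neg)
  then show ?thesis
    using id(5) unfolding w_def[symmetric] by (simp add: algebra_simps)
qed

text \<open>Two different values would be the two roots of the quadratic. For an outermost fourth
  vortex both are at least 9 m + 21, which makes their product too large. For an inner one both lie
  below t = 3 (1 + m), so the quadratic would be positive at t, whereas its value there is negative
  for m > -1/2.\<close>

lemma scaled_angular_velocity_unique:
  assumes eq: "collinear_three_one m \<omega> a b c d" and eq': "collinear_three_one m \<omega>' a' b' c' d'"
    and m: "m \<noteq> -1"
    and side: "a < d \<and> b < d \<and> c < d \<or> d < a \<and> d < b \<and> d < c \<longleftrightarrow>
      a' < d' \<and> b' < d' \<and> c' < d' \<or> d' < a' \<and> d' < b' \<and> d' < c'"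
  shows "\<omega> * d\<^sup>2 = \<omega>' * d'\<^sup>2"
proof (rule ccontr)
  assume ne: "\<omega> * d\<^sup>2 \<noteq> \<omega>' * d'\<^sup>2"
  define u v where "u = (3 + m) * (2 + m) * (\<omega> * d\<^sup>2)" and "v = (3 + m) * (2 + m) * (\<omega>' * d'\<^sup>2)"
  have m1: "m > -1"
  proof (cases "a < d \<and> b < d \<and> c < d \<or> d < a \<and> d < b \<and> d < c")
    case True
    then show ?thesis using same_side_imp_circulation_ge[OF eq] m by force
  next
    case False
    then show ?thesis using inner_imp_circulation_gt[OF eq m] by auto
  qed
  then have "u \<noteq> v"
    using ne by (simp add: u_def v_def)
  note V = quadratic_two_roots[OF
      scaled_angular_velocity_quadratic[OF eq, folded u_def]
      scaled_angular_velocity_quadratic[OF eq', folded v_def] this]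
  show False
  proof (cases "a < d \<and> b < d \<and> c < d \<or> d < a \<and> d < b \<and> d < c")
    case True
    then have "9 * m + 21 \<le> u" "9 * m + 21 \<le> v"
      using same_side_scaled_velocity_bound[OF eq m] same_side_scaled_velocity_bound[OF eq' m] side
      by (auto simp: u_def v_def)
    then have "(9 * m + 21) * (9 * m + 21) \<le> u * v"
      using m1 by (intro mult_mono) auto
    also have "u * v = 9 * (2 + m) * (3 + m)"
    proof -
      have "(1 + m) * (u * v) = (1 + m) * (9 * (2 + m) * (3 + m))"
        using V(1) by (simp add: algebra_simps)
      then show ?thesis using m1 by simp
    qed
    \<comment> \<open>The left-hand side is (9 m + 21)^2 - 9 (2 + m)(3 + m), expanded in powers of m
      + 1.\<close>
    finally have "72 * (m + 1)\<^sup>2 + 189 * (m + 1) + 126 \<le> 0"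
      by (simp add: power2_eq_square algebra_simps)
    then show False
      using m1 zero_le_power2[of "m + 1"] by argo
  next
    case False
    then have lt: "u < 3 * (1 + m)" "v < 3 * (1 + m)"
      using inner_scaled_velocity_bound[OF eq m] inner_scaled_velocity_bound[OF eq' m] side
      by (auto simp: u_def v_def)
    have m2: "m > -1/2"
      using inner_imp_circulation_gt[OF eq m] False by auto
    have "(1 + m) * ((u - 3 * (1 + m)) * (v - 3 * (1 + m))) > 0"
      using lt m1 by (simp add: mult_neg_neg)
    also have "(1 + m) * ((u - 3 * (1 + m)) * (v - 3 * (1 + m))) =
        - 6 * ((1 + m) * ((1 + 2 * m) * (3 + m)))"
      unfolding V(2)[of "3 * (1 + m)"] by (simp add: algebra_simps)
    finally have "0 < - 6 * ((1 + m) * ((1 + 2 * m) * (3 + m)))" .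
    moreover have "(1 + m) * ((1 + 2 * m) * (3 + m)) > 0"
      using m1 m2 by simp
    ultimately show False by linarith
  qed
qed


section \<open>Relabeling and uniqueness within a group\<close>

text \<open>The matrix depends on positions and angular velocity only through the products of
  \<omega> with the squared distances. So translation and scaling leave it fixed, and relabeling
  equal circulations permutes rows and columns alike.\<close>

lemma charpoly_A_mat_relabel:
  assumes "p permutes UNIV" "\<And>i. \<Gamma> $ p i = \<Gamma> $ i"
    and "\<And>i j. \<omega>' * (x' $ i - x' $ j)\<^sup>2 = \<omega> * (x $ p i - x $ p j)\<^sup>2"
  shows "charpoly (A_mat \<Gamma> \<omega>' (on_line x')) = charpoly (A_mat \<Gamma> \<omega> (on_line x))"
proof -
  define B where "B = A_mat \<Gamma> \<omega> (on_line x)"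
  have "inj p" "surj p"
    using assms(1) permutes_inj permutes_surj by blast+
  have div: "inverse u * g / v = g / (u * v)" for u g v :: real
    by (simp add: divide_inverse)
  have off: "A_mat \<Gamma> \<omega>' (on_line x') $ i $ j = B $ p i $ p j" if "i \<noteq> j" for i j
    using that \<open>inj p\<close> assms(2)[of j] assms(3)[of i j]
    by (simp add: B_def A_mat_def r_on_line inj_eq div)
  have "A_mat \<Gamma> \<omega>' (on_line x') $ i $ i = B $ p i $ p i" for i
  proof -
    have "A_mat \<Gamma> \<omega>' (on_line x') $ i $ i = - (\<Sum>k\<in>UNIV - {i}. A_mat \<Gamma> \<omega>' (on_line x') $ i $ k)"
      by (simp add: A_mat_def)
    also have "\<dots> = - (\<Sum>k\<in>UNIV - {i}. B $ p i $ p k)"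
      by (simp add: off)
    also have "(\<Sum>k\<in>UNIV - {i}. B $ p i $ p k) = (\<Sum>k\<in>p ` (UNIV - {i}). B $ p i $ k)"
      using \<open>inj p\<close> by (simp add: sum.reindex inj_on_subset)
    also have "p ` (UNIV - {i}) = UNIV - {p i}"
      using \<open>inj p\<close> \<open>surj p\<close> by (simp add: image_set_diff)
    also have "- (\<Sum>k\<in>UNIV - {p i}. B $ p i $ k) = B $ p i $ p i"
      by (simp add: B_def A_mat_def)
    finally show ?thesis .
  qed
  then have "A_mat \<Gamma> \<omega>' (on_line x') = (\<chi> i j. B $ p i $ p j)"
    using off by (simp add: vec_eq_iff) metis
  then show ?thesis
    using charpoly_permute[OF assms(1), of B] by (simp add: B_def)
qed

lemma relative_equilibrium_imp_collinear_three_one: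
  assumes re: "relative_equilibrium \<Gamma> \<omega> (on_line x)"
    and \<Gamma>: "\<Gamma> $ 1 = 1" "\<Gamma> $ 2 = 1" "\<Gamma> $ 3 = 1" "\<Gamma> $ 4 = m"
  defines "c \<equiv> center \<Gamma> (on_line x) $ 1"
  shows "collinear_three_one m \<omega> (x $ 1 - c) (x $ 2 - c) (x $ 3 - c) (x $ 4 - c)"
proof -
  note R = collinear_relative_equilibriumD[OF re]
  have t: "total_circ \<Gamma> = 3 + m"
    by (simp add: total_circ_def sum_4 \<Gamma>)
  have "c * total_circ \<Gamma> = x $ 1 + x $ 2 + x $ 3 + m * x $ 4"
    using R(1) by (simp add: c_def R(5) sum_4 \<Gamma>)
  then have center: "(x $ 1 - c) + (x $ 2 - c) + (x $ 3 - c) + m * (x $ 4 - c) = 0"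
    by (simp add: t algebra_simps)
  have sq: "g * u / u\<^sup>2 = g / u" for g u :: real
    by (simp add: power2_eq_square)
  note eq = R(4)[folded R(5), folded c_def]
  show ?thesis
    unfolding collinear_three_one_def
    using R(2) center R(3)[of 1 2] R(3)[of 1 3] R(3)[of 2 3] R(3)[of 1 4] R(3)[of 2 4] R(3)[of 3 4]
      eq[of 1] eq[of 2] eq[of 3] eq[of 4]
    by (simp add: sq sum_diff1 sum_4 \<Gamma>)
qed

text \<open>The uniqueness argument sees the groups through one dichotomy: the fourth vortex is
  outermost in Group I and between two others in Group II.\<close>

lemma normalized_in_group_I:
  assumes "normalized_in group_I x"
  shows "x $ 1 < x $ 4 \<and> x $ 2 < x $ 4 \<and> x $ 3 < x $ 4 \<or> x $ 4 < x $ 1 \<and> x $ 4 < x $ 2 \<and> x $ 4 < x $ 3"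
  using assms unfolding normalized_in_def group_I_def by auto

lemma normalized_in_group_II:
  assumes "normalized_in group_II x"
  shows "\<not> (x $ 1 < x $ 4 \<and> x $ 2 < x $ 4 \<and> x $ 3 < x $ 4 \<or> x $ 4 < x $ 1 \<and> x $ 4 < x $ 2 \<and> x $ 4 < x $ 3)"
  using assms unfolding normalized_in_def group_II_def by auto

lemma cubic_roots_unique:
  fixes a b c a' b' c' :: real
  assumes "a' + b' + c' = a + b + c" "a' * b' + a' * c' + b' * c' = a * b + a * c + b * c"
    "a' * b' * c' = a * b * c"
  shows "{a', b', c'} \<subseteq> {a, b, c}"
proof -
  have "y \<in> {a, b, c}" if "y \<in> {a', b', c'}" for y
  proof -
    have "(y - a) * (y - b) * (y - c) =
        y * y * y - (a + b + c) * (y * y) + (a * b + a * c + b * c) * y - a * b * c"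
      by (simp add: algebra_simps)
    also have "\<dots> = (y - a') * (y - b') * (y - c')"
      unfolding assms[symmetric] by (simp add: algebra_simps)
    also have "\<dots> = 0"
      using that by auto
    finally show ?thesis by auto
  qed
  then show ?thesis by blast
qed

text \<open>Both solutions have the same \<open>w\<close>, hence the same \<open>q\<close> and the
  same cubic, so their scaled positions agree up to a permutation of the equal vortices.\<close>

lemma nontrivial_eigenvals_A_unique:
  assumes re: "relative_equilibrium \<Gamma> \<omega> (on_line x)" and re': "relative_equilibrium \<Gamma> \<omega>' (on_line x')"
    and \<Gamma>: "\<Gamma> $ 1 = 1" "\<Gamma> $ 2 = 1" "\<Gamma> $ 3 = 1" and L: "L \<Gamma> \<noteq> 0"
    and side: "x $ 1 < x $ 4 \<and> x $ 2 < x $ 4 \<and> x $ 3 < x $ 4 \<or> x $ 4 < x $ 1 \<and> x $ 4 < x $ 2 \<and> x $ 4 < x $ 3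
      \<longleftrightarrow> x' $ 1 < x' $ 4 \<and> x' $ 2 < x' $ 4 \<and> x' $ 3 < x' $ 4 \<or> x' $ 4 < x' $ 1 \<and> x' $ 4 < x' $ 2 \<and> x' $ 4 < x' $ 3"
  shows "nontrivial_eigenvals_A \<Gamma> \<omega> (on_line x) = nontrivial_eigenvals_A \<Gamma> \<omega>' (on_line x')"
proof -
  define m where "m = \<Gamma> $ 4"
  \<comment> \<open>For these circulations L = 3 + 3 m.\<close>
  have m: "m \<noteq> -1"
    using L by (auto simp: L_def sum_pairs_4 \<Gamma> m_def)
  define c c' where "c = center \<Gamma> (on_line x) $ 1" and "c' = center \<Gamma> (on_line x') $ 1"
  define d d' where "d = x $ 4 - c" and "d' = x' $ 4 - c'"
  note eq = relative_equilibrium_imp_collinear_three_one[OF re \<Gamma> m_def[symmetric], folded c_def, folded d_def]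
  note eq' = relative_equilibrium_imp_collinear_three_one[OF re' \<Gamma> m_def[symmetric], folded c'_def, folded d'_def]
  define w where "w = \<omega> * d\<^sup>2"
  have w': "\<omega>' * d'\<^sup>2 = w"
    using scaled_angular_velocity_unique[OF eq eq' m] side by (simp add: w_def d_def d'_def)
  define z z' where "z i = (x $ i - x $ 4) / d" and "z' i = (x' $ i - x' $ 4) / d'" for i
  have zd: "(x $ i - c - d) / d = z i" "(x' $ i - c' - d') / d' = z' i" for i
    by (simp_all add: z_def z'_def d_def d'_def)
  note id = scaled_equilibrium_identities[OF eq, folded w_def, unfolded zd]
  note id' = scaled_equilibrium_identities[OF eq', unfolded w' zd]
  have "w * (z' 1 * z' 2 + z' 1 * z' 3 + z' 2 * z' 3) = w * (z 1 * z 2 + z 1 * z 3 + z 2 * z 3)"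
    using id(5) id'(5) by linarith
  then have e2: "z' 1 * z' 2 + z' 1 * z' 3 + z' 2 * z' 3 = z 1 * z 2 + z 1 * z 3 + z 2 * z 3"
    by (metis id(2) mult_left_cancel)
  have "w * (z' 1 * z' 2 * z' 3) = w * (z 1 * z 2 * z 3)"
    using id(4) id'(4) e2 by linarith
  then have e3: "z' 1 * z' 2 * z' 3 = z 1 * z 2 * z 3"
    by (metis id(2) mult_left_cancel)
  have e1: "z' 1 + z' 2 + z' 3 = z 1 + z 2 + z 3"
    using id(3) id'(3) by simp
  have z4: "z 4 = 0" "z' 4 = 0"
    by (simp_all add: z_def z'_def)
  have range: "range z' \<subseteq> range z"
  proof -
    have "range z' = insert (z' 4) {z' 1, z' 2, z' 3}"
      by (auto simp: UNIV_4)
    also have "\<dots> \<subseteq> insert (z 4) {z 1, z 2, z 3}"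
      unfolding z4 by (intro insert_mono cubic_roots_unique e1 e2 e3)
    also have "\<dots> \<subseteq> range z"
      by simp
    finally show ?thesis .
  qed
  have "inj z"
  proof (rule injI, rule ccontr)
    fix i j assume "z i = z j" "i \<noteq> j"
    then have "x $ i = x $ j"
      using id(1) by (simp add: z_def)
    with collinear_relative_equilibriumD(3)[OF re \<open>i \<noteq> j\<close>] show False ..
  qed
  have "inj z'"
  proof (rule injI, rule ccontr)
    fix i j assume "z' i = z' j" "i \<noteq> j"
    then have "x' $ i = x' $ j"
      using id'(1) by (simp add: z'_def)
    with collinear_relative_equilibriumD(3)[OF re' \<open>i \<noteq> j\<close>] show False ..
  qed
  \<comment> \<open>\<open>p\<close> matches equal scaled positions. It fixes 4, the one vortex at
    scaled position 0, and therefore preserves circulations.\<close>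
  define p where "p = inv z \<circ> z'"
  have zp: "z (p i) = z' i" for i
    using f_inv_into_f[of "z' i" z UNIV] range by (auto simp: p_def)
  then have "inj p"
    using \<open>inj z'\<close> unfolding inj_def by metis
  then have "p permutes UNIV"
    by (rule inj_imp_permutes) simp_all
  moreover have "\<Gamma> $ p i = \<Gamma> $ i" for i
  proof -
    have "p i = 4 \<longleftrightarrow> i = 4"
      using zp[of i] z4 \<open>inj z\<close> \<open>inj z'\<close> by (metis injD)
    moreover have "\<Gamma> $ k = 1" if "k \<noteq> 4" for k
      using that exhaust_4[of k] \<Gamma> by auto
    ultimately show ?thesis by (cases "i = 4") auto
  qed
  moreover have "\<omega>' * (x' $ i - x' $ j)\<^sup>2 = \<omega> * (x $ p i - x $ p j)\<^sup>2" for i j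
  proof -
    have "x' $ i - x' $ j = d' * (z' i - z' j)" "x $ p i - x $ p j = d * (z (p i) - z (p j))"
      using id(1) id'(1) by (simp_all add: z_def z'_def diff_divide_distrib[symmetric])
    then show ?thesis
      unfolding zp using w' w_def by (simp add: power_mult_distrib mult.assoc[symmetric])
  qed
  ultimately have "charpoly (A_mat \<Gamma> \<omega>' (on_line x')) = charpoly (A_mat \<Gamma> \<omega> (on_line x))"
    by (rule charpoly_A_mat_relabel)
  then show ?thesis
    by (simp add: nontrivial_eigenvals_A_def eigenvals_def)
qed

subsection \<open>The linearization in the plane\<close>

text \<open>Indices (vortex, axis) are grouped by axis, which gives the blocks in the coordinates
  x_1, ..., x_4, y_1, ..., y_4.\<close>

definition block_mat :: "real ^ 4 ^ 4 \<Rightarrow> real ^ 4 ^ 4 \<Rightarrow> real ^ 4 ^ 4 \<Rightarrow> real ^ 4 ^ 4 \<Rightarrow> real ^ (4 \<times> 2) ^ (4 \<times> 2)" where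
  "block_mat F G H J = (\<chi> p q. (if snd p = 1 then if snd q = 1 then F else G else if snd q = 1 then H else J) $ fst p $ fst q)"

definition join :: "real ^ 4 \<Rightarrow> real ^ 4 \<Rightarrow> config" where
  "join u v = (\<chi> p. if snd p = 1 then u $ fst p else v $ fst p)"

lemma sum_axes:
  "(\<Sum>p\<in>UNIV. f p) = (\<Sum>i\<in>UNIV. f (i, 1) + f (i, 2 :: 2))"
proof -
  have "(\<Sum>p\<in>UNIV. f p) = (\<Sum>i\<in>UNIV. \<Sum>k\<in>UNIV. f (i, k))"
    by (simp add: sum.cartesian_product)
  then show ?thesis by (simp add: sum_2)
qed

lemma config_eqI:
  fixes u v :: "'a ^ (4 \<times> 2)"
  assumes "\<And>i. u $ (i, 1) = v $ (i, 1)" "\<And>i. u $ (i, 2) = v $ (i, 2)"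
  shows "u = v"
  unfolding vec_eq_iff
proof (intro allI)
  fix p :: "4 \<times> 2"
  show "u $ p = v $ p"
    using assms exhaust_2[of "snd p"] by (cases p) auto
qed

lemma block_mat_mult:
  "block_mat F G H J ** block_mat F' G' H' J' =
    block_mat (F ** F' + G ** H') (F ** G' + G ** J') (H ** F' + J ** H') (H ** G' + J ** J')"
  by (intro config_eqI) (simp_all add: block_mat_def matrix_matrix_mult_def sum_axes sum.distrib)

lemma block_mat_mult_join:
  "block_mat F G H J *v join u v = join (F *v u + G *v v) (H *v u + J *v v)"
  by (intro config_eqI) (simp_all add: block_mat_def join_def matrix_vector_mult_def sum_axes sum.distrib)

lemma block_mat_scaleR: "c *\<^sub>R block_mat F G H J = block_mat (c *\<^sub>R F) (c *\<^sub>R G) (c *\<^sub>R H) (c *\<^sub>R J)"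
  by (intro config_eqI) (simp_all add: block_mat_def)

lemma block_mat_add:
  "block_mat F G H J + block_mat F' G' H' J' = block_mat (F + F') (G + G') (H + H') (J + J')"
  by (intro config_eqI) (simp_all add: block_mat_def)

lemma mat_1_eq_block_mat: "mat 1 = block_mat (mat 1) 0 0 (mat 1)"
  by (intro config_eqI) (simp_all add: block_mat_def mat_def)

lemma K_mat_eq_block_mat: "K_mat = block_mat 0 (mat 1) (- mat 1) 0"
  by (intro config_eqI) (simp_all add: block_mat_def mat_def K_mat_def)

lemma M_mat_eq_block_mat: "M_mat \<Gamma> = block_mat (\<chi> i j. if i = j then \<Gamma> $ i else 0) 0 0 (\<chi> i j. if i = j then \<Gamma> $ i else 0)"
  by (intro config_eqI) (simp_all add: block_mat_def M_mat_def)

lemma join_add: "join u v + join u' v' = join (u + u') (v + v')"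
  and join_scaleR: "c *\<^sub>R join u v = join (c *\<^sub>R u) (c *\<^sub>R v)"
  by (intro config_eqI; simp add: join_def)+

lemma join_minus: "- join u v = join (- u) (- v)"
  using join_scaleR[of "-1" u v] by simp

lemma on_line_eq_join: "on_line x = join x 0"
  by (intro config_eqI) (simp_all add: join_def on_line_def)

lemma join_cases: obtains u v where "w = join u v"
proof
  show "w = join (\<chi> i. w $ (i, 1)) (\<chi> i. w $ (i, 2))"
    by (intro config_eqI) (simp_all add: join_def)
qed

lemma inner_join: "join u v \<bullet> join u' v' = u \<bullet> u' + v \<bullet> v'"
  by (simp add: inner_vec_def sum_axes join_def sum.distrib)

section \<open>First and second derivatives of the Hamiltonian\<close>

definition sqdist :: "config \<Rightarrow> 4 \<Rightarrow> 4 \<Rightarrow> real" where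
  "sqdist z i j = (z $ (i, 1) - z $ (j, 1))\<^sup>2 + (z $ (i, 2) - z $ (j, 2))\<^sup>2"

lemma r_eq_sqrt_sqdist: "r z i j = sqrt (sqdist z i j)"
  by (simp add: r_def dist_vec_def L2_set_def sum_2 vortex_def sqdist_def dist_real_def)

text \<open>Coinciding vortices are covered too, since \<open>ln 0\<close> is 0.\<close>

lemma ln_r: "ln (r z i j) = ln (sqdist z i j) / 2"
proof (cases "sqdist z i j = 0")
  case False
  then have "sqdist z i j > 0"
    by (simp add: sqdist_def order_less_le)
  then show ?thesis
    by (simp add: r_eq_sqrt_sqdist ln_sqrt)
qed (simp add: r_eq_sqrt_sqdist)

lemma sqdist_pos_iff: "0 < sqdist z i j \<longleftrightarrow> vortex z i \<noteq> vortex z j"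
proof -
  have "0 < sqdist z i j \<longleftrightarrow> 0 < r z i j"
    by (simp add: r_eq_sqrt_sqdist)
  then show ?thesis by (simp add: r_def)
qed

lemma axis_shift_diff:
  "(z + t *\<^sub>R axis (a, k) 1) $ (i, l) - (z + t *\<^sub>R axis (a, k) 1) $ (j, l) =
    z $ (i, l) - z $ (j, l) + t * (of_bool (k = l) * (of_bool (i = a) - of_bool (j = a)))"
  for z :: config
  by (auto simp: axis_def)

lemma DERIV_sqdist_shift:
  "((\<lambda>t. sqdist (z + t *\<^sub>R axis (a, k) 1) i j) has_real_derivative
      2 * (of_bool (i = a) - of_bool (j = a)) * (z $ (i, k) - z $ (j, k))) (at 0)"
  unfolding sqdist_def axis_shift_diff
  using exhaust_2[of k] by (auto intro!: derivative_eq_intros)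

text \<open>The formula for the first derivatives is proved at configurations without collisions. To
  differentiate it again, it must hold throughout a neighbourhood.\<close>

lemma eventually_inj_vortex_shift:
  assumes "inj (vortex z)"
  shows "\<forall>\<^sub>F t in nhds 0. inj (vortex (z + t *\<^sub>R axis (a, k) 1))"
proof -
  have ev: "\<forall>\<^sub>F t in nhds 0. sqdist (z + t *\<^sub>R axis (a, k) 1) i j > 0" if "i \<noteq> j" for i j
  proof -
    have "isCont (\<lambda>t. sqdist (z + t *\<^sub>R axis (a, k) 1) i j) 0"
      using DERIV_sqdist_shift DERIV_isCont by blast
    then have "((\<lambda>t. sqdist (z + t *\<^sub>R axis (a, k) 1) i j) \<longlongrightarrow> sqdist z i j) (nhds 0)"
      by (simp add: isCont_def tendsto_nhds_iff)
    moreover have "sqdist z i j > 0"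
      using assms that by (simp add: sqdist_pos_iff inj_eq)
    ultimately show ?thesis
      by (simp add: order_tendstoD(1))
  qed
  have "\<forall>\<^sub>F t in nhds 0. \<forall>i j. i \<noteq> j \<longrightarrow> sqdist (z + t *\<^sub>R axis (a, k) 1) i j > 0"
  proof (intro eventually_all_finite)
    fix i j
    show "\<forall>\<^sub>F t in nhds 0. i \<noteq> j \<longrightarrow> sqdist (z + t *\<^sub>R axis (a, k) 1) i j > 0"
      using ev[of i j] by (cases "i = j") auto
  qed
  then show ?thesis
    by (rule eventually_mono) (auto simp: sqdist_pos_iff inj_def)
qed

lemma partial_deriv_hamiltonian:
  assumes "inj (vortex z)"
  shows "partial_deriv (a, k) (hamiltonian \<Gamma>) z =
    - (\<Sum>(i, j)\<in>{(i, j). i < j}. \<Gamma> $ i * \<Gamma> $ j *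
        ((of_bool (i = a) - of_bool (j = a)) * (z $ (i, k) - z $ (j, k)) / sqdist z i j))"
  unfolding partial_deriv_def hamiltonian_def
proof (rule DERIV_imp_deriv, rule DERIV_minus, unfold case_prod_unfold, rule DERIV_sum)
  fix p :: "4 \<times> 4" assume "p \<in> {p. fst p < snd p}"
  then have pos: "sqdist z (fst p) (snd p) > 0"
    using assms by (auto simp: sqdist_pos_iff dest: injD)
  show "((\<lambda>t. \<Gamma> $ fst p * \<Gamma> $ snd p * ln (r (z + t *\<^sub>R axis (a, k) 1) (fst p) (snd p))) has_real_derivative
     \<Gamma> $ fst p * \<Gamma> $ snd p * ((of_bool (fst p = a) - of_bool (snd p = a)) *
       (z $ (fst p, k) - z $ (snd p, k)) / sqdist z (fst p) (snd p))) (at 0)"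
    unfolding ln_r
    by (rule derivative_eq_intros DERIV_sqdist_shift refl | simp add: pos)+
       (use pos in \<open>auto simp: divide_simps algebra_simps\<close>)
qed

lemma hessian_hamiltonian:
  assumes "inj (vortex z)"
  shows "hessian (hamiltonian \<Gamma>) z $ (b, l) $ (a, k) =
    - (\<Sum>(i, j)\<in>{(i, j). i < j}. \<Gamma> $ i * \<Gamma> $ j *
        ((of_bool (i = a) - of_bool (j = a)) * (of_bool (i = b) - of_bool (j = b)) *
         (of_bool (k = l) / sqdist z i j
          - 2 * (z $ (i, k) - z $ (j, k)) * (z $ (i, l) - z $ (j, l)) / (sqdist z i j)\<^sup>2)))"
proof -
  let ?F = "\<lambda>w. - (\<Sum>(i, j)\<in>{(i, j). i < j}. \<Gamma> $ i * \<Gamma> $ j *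
        ((of_bool (i = a) - of_bool (j = a)) * (w $ (i, k) - w $ (j, k)) / sqdist w i j))"
  have "hessian (hamiltonian \<Gamma>) z $ (b, l) $ (a, k) =
      deriv (\<lambda>t. partial_deriv (a, k) (hamiltonian \<Gamma>) (z + t *\<^sub>R axis (b, l) 1)) 0"
    by (simp add: hessian_def partial_deriv_def)
  also have "\<dots> = deriv (\<lambda>t. ?F (z + t *\<^sub>R axis (b, l) 1)) 0"
    \<comment> \<open>The inner partial derivative is replaced by its formula near t = 0 before the
      second differentiation.\<close>
    by (intro deriv_cong_ev eventually_mono[OF eventually_inj_vortex_shift[OF assms]]
        partial_deriv_hamiltonian refl)
  also have "\<dots> = - (\<Sum>(i, j)\<in>{(i, j). i < j}. \<Gamma> $ i * \<Gamma> $ j *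
        ((of_bool (i = a) - of_bool (j = a)) * (of_bool (i = b) - of_bool (j = b)) *
         (of_bool (k = l) / sqdist z i j
          - 2 * (z $ (i, k) - z $ (j, k)) * (z $ (i, l) - z $ (j, l)) / (sqdist z i j)\<^sup>2)))"
  proof (rule DERIV_imp_deriv, rule DERIV_minus, unfold case_prod_unfold, rule DERIV_sum)
    fix p :: "4 \<times> 4" assume "p \<in> {p. fst p < snd p}"
    then have pos: "sqdist z (fst p) (snd p) > 0"
      using assms by (auto simp: sqdist_pos_iff dest: injD)
    show "((\<lambda>t. \<Gamma> $ fst p * \<Gamma> $ snd p * ((of_bool (fst p = a) - of_bool (snd p = a)) *
         ((z + t *\<^sub>R axis (b, l) 1) $ (fst p, k) - (z + t *\<^sub>R axis (b, l) 1) $ (snd p, k)) /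
         sqdist (z + t *\<^sub>R axis (b, l) 1) (fst p) (snd p))) has_real_derivative
       \<Gamma> $ fst p * \<Gamma> $ snd p * ((of_bool (fst p = a) - of_bool (snd p = a)) *
        (of_bool (fst p = b) - of_bool (snd p = b)) *
         (of_bool (k = l) / sqdist z (fst p) (snd p)
          - 2 * (z $ (fst p, k) - z $ (snd p, k)) * (z $ (fst p, l) - z $ (snd p, l)) / (sqdist z (fst p) (snd p))\<^sup>2)))
       (at 0)"
      unfolding axis_shift_diff
      by (rule derivative_eq_intros DERIV_sqdist_shift refl | simp add: pos less_imp_neq[OF pos, symmetric])+
         (use pos in \<open>auto simp: divide_simps power2_eq_square algebra_simps\<close>)
  qed
  finally show ?thesis .
qed

text \<open>Off the diagonal both sides equal -\<Gamma>_i \<Gamma>_j / (\<omega> r_ij^2). Thus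
  \<open>A\<close> is selfadjoint for the bilinear form with weights \<Gamma>, which may be
  indefinite.\<close>

lemma weighted_A_mat_symmetric:
  "\<Gamma> $ i * A_mat \<Gamma> \<omega> z $ i $ j = \<Gamma> $ j * A_mat \<Gamma> \<omega> z $ j $ i"
  by (cases "i = j") (simp_all add: A_mat_def r_def dist_commute)

text \<open>On a line the y-differences vanish, which kills the mixed derivatives. A pair at signed
  distance e contributes 1/e^2 - 2 e^2/e^4 = -1/e^2 along the line and 1/e^2 across it, hence the
  opposite signs of the two blocks.\<close>

lemma hessian_hamiltonian_on_line:
  fixes \<Gamma> x :: "real ^ 4" and \<omega> :: real
  assumes inj: "inj (($) x)" and "\<omega> \<noteq> 0"
  defines "W \<equiv> \<omega> *\<^sub>R (\<chi> i j. \<Gamma> $ i * A_mat \<Gamma> \<omega> (on_line x) $ i $ j)"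
  shows "hessian (hamiltonian \<Gamma>) (on_line x) = block_mat W 0 0 (- W)"
proof -
  have v: "on_line x $ (i, 1) = x $ i" "on_line x $ (i, 2) = 0" for i
    by (simp_all add: on_line_def)
  have sq: "sqdist (on_line x) i j = (x $ i - x $ j)\<^sup>2" for i j
    by (simp add: sqdist_def v)
  have "inj (vortex (on_line x))"
  proof (rule injI)
    fix i j assume "vortex (on_line x) i = vortex (on_line x) j"
    then have "vortex (on_line x) i $ 1 = vortex (on_line x) j $ 1" by simp
    then show "i = j"
      using inj by (simp add: vortex_def v inj_eq)
  qed
  note H = hessian_hamiltonian[OF this]
  define S where "S a b = (\<Sum>(i, j)\<in>{(i, j). i < j}. \<Gamma> $ i * \<Gamma> $ j *
      ((of_bool (i = a) - of_bool (j = a)) * (of_bool (i = b) - of_bool (j = b)) / (x $ i - x $ j)\<^sup>2))"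
    for a b
  have sym: "(x $ i - x $ j)\<^sup>2 = (x $ j - x $ i)\<^sup>2" for i j
    by (simp add: power2_commute)
  have S: "S a b = W $ b $ a" for a b
  proof -
    have off: "W $ b $ a = - (\<Gamma> $ b * \<Gamma> $ a / (x $ b - x $ a)\<^sup>2)" if "a \<noteq> b" for a b
      using that \<open>\<omega> \<noteq> 0\<close> by (simp add: W_def A_mat_def r_on_line)
    have diag: "W $ a $ a = (\<Sum>j\<in>UNIV - {a}. \<Gamma> $ a * \<Gamma> $ j / (x $ a - x $ j)\<^sup>2)" for a
    proof -
      have c: "\<omega> * (g * (inverse \<omega> * y)) = g * y" for g y
        using \<open>\<omega> \<noteq> 0\<close> by simp
      show ?thesis
        by (simp add: c W_def A_mat_def r_on_line sum_negf sum_distrib_left mult.assoc divide_inverse)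
    qed
    have "\<forall>a b. S a b = W $ b $ a"
      unfolding forall_4 S_def sum_pairs_4
      using sym[of 1 2] sym[of 1 3] sym[of 1 4] sym[of 2 3] sym[of 2 4] sym[of 3 4]
      by (simp add: off diag sum_diff1 sum_4 ac_simps)
    then show ?thesis by simp
  qed
  have c: "1 / e\<^sup>2 - 2 * e * e / (e\<^sup>2)\<^sup>2 = - 1 / e\<^sup>2" if "e \<noteq> 0" for e :: real
    using that by (simp add: field_simps power2_eq_square)
  have "hessian (hamiltonian \<Gamma>) (on_line x) $ (b, 1) $ (a, 1) = W $ b $ a" for a b
  proof -
    have "hessian (hamiltonian \<Gamma>) (on_line x) $ (b, 1) $ (a, 1) = S a b"
      unfolding H S_def sum_negf[symmetric] v sq
    proof (intro sum.cong refl, clarify)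
      fix i j :: 4 assume "i < j"
      then have "x $ i - x $ j \<noteq> 0"
        using inj by (auto dest: injD)
      then have "of_bool ((1::2) = 1) / (x $ i - x $ j)\<^sup>2 - 2 * (x $ i - x $ j) * (x $ i - x $ j) / ((x $ i - x $ j)\<^sup>2)\<^sup>2
          = - 1 / (x $ i - x $ j)\<^sup>2"
        using c[of "x $ i - x $ j"] by simp
      then show "- (\<Gamma> $ i * \<Gamma> $ j * ((of_bool (i = a) - of_bool (j = a)) * (of_bool (i = b) - of_bool (j = b)) *
           (of_bool ((1::2) = 1) / (x $ i - x $ j)\<^sup>2 - 2 * (x $ i - x $ j) * (x $ i - x $ j) / ((x $ i - x $ j)\<^sup>2)\<^sup>2))) =
         \<Gamma> $ i * \<Gamma> $ j * ((of_bool (i = a) - of_bool (j = a)) * (of_bool (i = b) - of_bool (j = b)) / (x $ i - x $ j)\<^sup>2)"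
        by (simp only:) simp
    qed
    then show ?thesis using S by simp
  qed
  moreover have "hessian (hamiltonian \<Gamma>) (on_line x) $ (b, 2) $ (a, 2) = - W $ b $ a" for a b
    unfolding H S[symmetric] S_def sq v by (simp add: case_prod_unfold)
  moreover have "hessian (hamiltonian \<Gamma>) (on_line x) $ (b, k) $ (a, l) = 0" if "k \<noteq> l" for a b k l
    unfolding H sq using that exhaust_2[of k] exhaust_2[of l] by (auto simp: v case_prod_unfold)
  ultimately show ?thesis
    by (simp add: vec_eq_iff block_mat_def forall_2)
qed

lemma matrix_inv_eqI:
  fixes A :: "real ^ 'n ^ 'n"
  assumes "A ** B = mat 1" "B ** A = mat 1"
  shows "matrix_inv A = B"
proof -
  have "A ** matrix_inv A = mat 1"
    unfolding matrix_inv_def by (rule someI2[of _ B]) (use assms in auto)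
  then have "B ** (A ** matrix_inv A) = B"
    by simp
  then show ?thesis
    using assms by (simp add: matrix_mul_assoc)
qed

text \<open>\<open>W\<close> is \<omega> times the weighted matrix \<Gamma>_i A_ij, so dividing by
  the circulations and \<omega> leaves the blocks A and -A; adding the identity and multiplying by K
  gives the claim.\<close>

lemma stability_matrix_on_line:
  fixes \<Gamma> x :: "real ^ 4" and \<omega> :: real
  assumes inj: "inj (($) x)" and "\<omega> \<noteq> 0" and \<Gamma>: "\<And>i. \<Gamma> $ i \<noteq> 0"
  defines "A \<equiv> A_mat \<Gamma> \<omega> (on_line x)"
  shows "stability_matrix \<Gamma> \<omega> (on_line x) = block_mat 0 (mat 1 - A) (- (mat 1 + A)) 0"
proof -
  define Md where "Md = (\<chi> i j :: 4. if i = j then \<Gamma> $ i else 0)"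
  define Mi where "Mi = (\<chi> i j :: 4. if i = j then inverse (\<Gamma> $ i) else 0)"
  define W where "W = \<omega> *\<^sub>R (\<chi> i j. \<Gamma> $ i * A $ i $ j)"
  have "Md ** Mi = mat 1" "Mi ** Md = mat 1"
    using \<Gamma> by (simp_all add: vec_eq_iff matrix_matrix_mult_def Md_def Mi_def mat_def
        if_distrib[of "\<lambda>t. t * _"] cong: if_cong)
  then have inv: "matrix_inv (M_mat \<Gamma>) = block_mat Mi 0 0 Mi"
    by (intro matrix_inv_eqI)
      (simp_all add: M_mat_eq_block_mat Md_def[symmetric] block_mat_mult mat_1_eq_block_mat)
  have "Mi ** W = \<omega> *\<^sub>R A"
    using \<Gamma> by (simp add: vec_eq_iff matrix_matrix_mult_def Mi_def W_def
        if_distrib[of "\<lambda>t. t * _"] cong: if_cong)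
  moreover have "Mi ** (- W) = - (Mi ** W)"
    by (simp add: vec_eq_iff matrix_matrix_mult_def sum_negf)
  ultimately have "inverse \<omega> *\<^sub>R (block_mat Mi 0 0 Mi ** block_mat W 0 0 (- W)) = block_mat A 0 0 (- A)"
    using \<open>\<omega> \<noteq> 0\<close> by (simp add: block_mat_mult block_mat_scaleR)
  moreover have neg: "(- mat 1) ** B = - B" for B :: "real ^ 4 ^ 4"
    by (simp add: vec_eq_iff matrix_matrix_mult_def mat_def if_distrib[of "\<lambda>t. t * _"] sum_negf cong: if_cong)
  ultimately show ?thesis
    unfolding stability_matrix_def inv hessian_hamiltonian_on_line[OF inj \<open>\<omega> \<noteq> 0\<close>]
      A_def[symmetric] W_def[symmetric]
    by (simp add: mat_1_eq_block_mat K_mat_eq_block_mat block_mat_add block_mat_mult minus_diff_commute[of A])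
qed

subsection \<open>Linear stability\<close>

definition columns4 :: "real ^ 4 \<Rightarrow> real ^ 4 \<Rightarrow> real ^ 4 \<Rightarrow> real ^ 4 \<Rightarrow> real ^ 4 ^ 4" where
  "columns4 a b c d = (\<chi> i j. (if j = 1 then a else if j = 2 then b else if j = 3 then c else d) $ i)"

lemma mult_columns4: "A ** columns4 a b c d = columns4 (A *v a) (A *v b) (A *v c) (A *v d)"
  by (simp add: vec_eq_iff matrix_matrix_mult_def matrix_vector_mult_def columns4_def)

lemma columns4_mult_vector:
  "columns4 a b c d *v w = w $ 1 *\<^sub>R a + w $ 2 *\<^sub>R b + w $ 3 *\<^sub>R c + w $ 4 *\<^sub>R d"
  by (simp add: vec_eq_iff matrix_vector_mult_def columns4_def sum_4 mult.commute)

lemma det_nonzero_of_surj: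
  fixes P :: "real ^ 'n ^ 'n"
  assumes "surj ((*v) P)"
  shows "det P \<noteq> 0"
  using assms matrix_right_invertible_surjective invertible_right_inverse invertible_det_nz by blast

lemma in_span_pairD:
  assumes "x \<in> span {a, b}"
  obtains k l where "x = k *\<^sub>R a + l *\<^sub>R b"
proof -
  obtain k where "x - k *\<^sub>R a \<in> span {b}"
    using assms by (auto simp: span_breakdown_eq)
  then obtain l where "x - k *\<^sub>R a = l *\<^sub>R b"
    by (auto simp: span_singleton)
  then have "x = k *\<^sub>R a + l *\<^sub>R b"
    by (simp add: algebra_simps)
  then show thesis ..
qed

lemma weighted_selfadjoint:
  fixes A :: "real ^ 'n ^ 'n" and g u w :: "real ^ 'n"
  assumes "\<And>i j. g $ i * A $ i $ j = g $ j * A $ j $ i"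
  shows "(\<Sum>i\<in>UNIV. g $ i * (A *v u) $ i * w $ i) = (\<Sum>i\<in>UNIV. g $ i * u $ i * (A *v w) $ i)"
proof -
  have "(\<Sum>i\<in>UNIV. g $ i * (A *v u) $ i * w $ i) = (\<Sum>i\<in>UNIV. \<Sum>j\<in>UNIV. (g $ i * A $ i $ j) * u $ j * w $ i)"
    by (simp add: matrix_vector_mult_def sum_distrib_left sum_distrib_right mult.assoc)
  also have "\<dots> = (\<Sum>i\<in>UNIV. \<Sum>j\<in>UNIV. (g $ j * A $ j $ i) * u $ j * w $ i)"
    by (simp only: assms)
  also have "\<dots> = (\<Sum>j\<in>UNIV. \<Sum>i\<in>UNIV. (g $ j * A $ j $ i) * u $ j * w $ i)"
    by (rule sum.swap)
  also have "\<dots> = (\<Sum>i\<in>UNIV. g $ i * u $ i * (A *v w) $ i)"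
    by (simp add: matrix_vector_mult_def sum_distrib_left mult_ac)
  finally show ?thesis .
qed

text \<open>The matrix has columns (a, b) and (c, d). Both (c, l - a) and (l - d, b) solve the
  eigenvector equations, and both vanish only if the matrix is l times the identity.\<close>

lemma eigenvector_2x2:
  fixes a b c d l :: real
  assumes "l * l - (a + d) * l + (a * d - b * c) = 0"
  obtains s t where "s \<noteq> 0 \<or> t \<noteq> 0" "a * s + c * t = l * s" "b * s + d * t = l * t"
proof -
  have key: "b * c + d * (l - a) = l * (l - a)" "a * (l - d) + c * b = l * (l - d)"
    using assms by (simp_all add: algebra_simps)
  consider "c \<noteq> 0 \<or> l \<noteq> a" | "b \<noteq> 0 \<or> l \<noteq> d" | "c = 0" "b = 0" "l = a"
    by blast
  then show thesis
  proof cases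
    case 1
    then show thesis using key(1) by (intro that[of c "l - a"]) (auto simp: algebra_simps)
  next
    case 2
    then show thesis using key(2) by (intro that[of "l - d" b]) (auto simp: algebra_simps)
  next
    case 3
    then show thesis by (intro that[of 1 0]) auto
  qed
qed

text \<open>
  If \<open>0\<close> is a double eigenvalue, an eigenvector for the nontrivial eigenvalue \<open>0\<close> has to be found in
  the weighted orthogonal complement of \<open>1\<close> and \<open>y\<close>; the restriction of \<open>A\<close> to that plane has
  trace \<open>l1 + l2\<close> and determinant \<open>l1 * l2\<close>.
\<close>

lemma nontrivial_eigenvectors:
  fixes A :: "real ^ 4 ^ 4" and g y :: "real ^ 4" and l1 l2 :: real
  assumes sym: "\<And>i j. g $ i * A $ i $ j = g $ j * A $ j $ i"
    and ev: "A *v 1 = 0" "A *v y = y"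
    and g1: "(\<Sum>i\<in>UNIV. g $ i) \<noteq> 0" and gy: "(\<Sum>i\<in>UNIV. g $ i * y $ i) = 0"
    and gyy: "(\<Sum>i\<in>UNIV. g $ i * y $ i * y $ i) \<noteq> 0"
    and cp: "charpoly A = [:0, 1:] * [:-1, 1:] * [:complex_of_real (l1 * l2), - complex_of_real (l1 + l2), 1:]"
    and "l1 \<noteq> l2"
  obtains v1 v2 where "A *v v1 = l1 *\<^sub>R v1" "A *v v2 = l2 *\<^sub>R v2"
    "(\<Sum>i\<in>UNIV. g $ i * y $ i * v1 $ i) = 0" "(\<Sum>i\<in>UNIV. g $ i * y $ i * v2 $ i) = 0"
    "surj ((*v) (columns4 1 y v1 v2))"
proof -
  define h where "h = (\<chi> i. g $ i * y $ i)"
  define W where "W = {u. g \<bullet> u = 0 \<and> h \<bullet> u = 0}"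
  have gh: "g \<bullet> 1 \<noteq> 0" "h \<bullet> 1 = 0" "g \<bullet> y = 0" "h \<bullet> y \<noteq> 0"
    using g1 gy gyy by (simp_all add: inner_vec_def h_def)
  have subW: "subspace W"
    by (auto simp: W_def subspace_def inner_right_distrib)
  \<comment> \<open>Selfadjointness moves \<open>A\<close> onto its eigenvectors 1 and
    \<open>y\<close>, so the orthogonal complement \<open>W\<close> of both is invariant.\<close>
  have AW: "A *v u \<in> W" if "u \<in> W" for u
  proof -
    have "g \<bullet> (A *v u) = (\<Sum>i\<in>UNIV. g $ i * u $ i * (A *v 1) $ i)"
      using weighted_selfadjoint[OF sym, of u 1] by (simp add: inner_vec_def)
    moreover have "h \<bullet> (A *v u) = (\<Sum>i\<in>UNIV. g $ i * u $ i * (A *v y) $ i)"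
      using weighted_selfadjoint[OF sym, of u y] by (simp add: inner_vec_def h_def mult_ac)
    moreover have "(\<Sum>i\<in>UNIV. g $ i * u $ i * y $ i) = h \<bullet> u"
      by (simp add: inner_vec_def h_def mult_ac)
    ultimately show ?thesis
      using that unfolding ev by (simp add: W_def)
  qed
  have dimW: "dim W = 2"
  proof -
    have "g \<notin> span {h}"
      using gh by (auto simp: span_singleton)
    moreover have "h \<noteq> 0"
      using gh by auto
    ultimately have "independent {g, h}" "g \<noteq> h"
      by (auto simp: independent_insert span_base)
    then have "dim {g, h} = 2"
      by (simp add: dim_eq_card_independent)
    moreover have "W = {u \<in> UNIV. \<forall>x\<in>span {g, h}. orthogonal x u}"
    proof -
      have "orthogonal x u" if "u \<in> W" "x \<in> span {g, h}" for x u
        using that by (auto simp: W_def orthogonal_def inner_left_distrib elim!: in_span_pairD)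
      moreover have "u \<in> W" if "\<forall>x\<in>span {g, h}. orthogonal x u" for u
        using that by (auto simp: W_def orthogonal_def span_base)
      ultimately show ?thesis by auto
    qed
    moreover have "dim {u \<in> (UNIV :: (real ^ 4) set). \<forall>x\<in>span {g, h}. orthogonal x u} + dim (span {g, h}) = dim (UNIV :: (real ^ 4) set)"
      by (rule dim_subspace_orthogonal_to_vectors) auto
    ultimately show ?thesis by simp
  qed
  \<comment> \<open>Subtracting the weighted projections onto 1 and \<open>y\<close> puts any vector
    into \<open>W\<close>; the denominators are nonzero because neither vector is isotropic for the
    weighted form.\<close>
  have surj: "surj ((*v) (columns4 1 y v w))" if "W \<subseteq> span {v, w}" for v w
  proof (unfold surj_def, intro allI)
    fix x :: "real ^ 4"
    define a where "a = g \<bullet> x / (g \<bullet> 1)"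
    define b where "b = h \<bullet> x / (h \<bullet> y)"
    have "x - a *\<^sub>R 1 - b *\<^sub>R y \<in> W"
      using gh by (simp add: W_def inner_diff_right a_def b_def)
    then obtain k l where "x - a *\<^sub>R 1 - b *\<^sub>R y = k *\<^sub>R v + l *\<^sub>R w"
      using \<open>W \<subseteq> span {v, w}\<close> in_span_pairD by blast
    then have "x = columns4 1 y v w *v (\<chi> i. if i = 1 then a else if i = 2 then b else if i = 3 then k else l)"
      by (simp add: columns4_mult_vector algebra_simps)
    then show "\<exists>c. x = columns4 1 y v w *v c" ..
  qed
  obtain B where B: "B \<subseteq> W" "independent B" "W \<subseteq> span B" "card B = 2"
    using basis_exists[of W] dimW by metis
  obtain u1 u2 where u: "B = {u1, u2}" "u1 \<noteq> u2"
    using B(4) by (auto simp: card_2_iff)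
  have "A *v u1 \<in> span {u1, u2}" "A *v u2 \<in> span {u1, u2}"
    using AW B u by blast+
  then obtain a b c d where Au1: "A *v u1 = a *\<^sub>R u1 + b *\<^sub>R u2" and Au2: "A *v u2 = c *\<^sub>R u1 + d *\<^sub>R u2"
    by (metis in_span_pairD)
  \<comment> \<open>\<open>N\<close> is the matrix of \<open>A\<close> in the basis 1, y, u1, u2:
    diagonal entries 0 and 1, followed by the 2 x 2 block of the restriction to
    \<open>W\<close>.\<close>
  define N :: "real ^ 4 ^ 4" where "N = columns4 0 (axis 2 1) (a *\<^sub>R axis 3 1 + b *\<^sub>R axis 4 1) (c *\<^sub>R axis 3 1 + d *\<^sub>R axis 4 1)"
  have "A ** columns4 1 y u1 u2 = columns4 1 y u1 u2 ** N"
    unfolding N_def mult_columns4 ev Au1 Au2 columns4_mult_vector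
    by (simp add: axis_def)
  then have "charpoly A = charpoly N"
    using surj[of u1 u2] B u by (intro charpoly_similar det_nonzero_of_surj) auto
  moreover have "charpoly N = map_poly complex_of_real [:0, - (a * d - b * c), a + d + (a * d - b * c), - (1 + a + d), 1:]"
    unfolding charpoly_4 by (simp add: N_def columns4_def axis_def det_4 algebra_simps)
  moreover have "charpoly A = map_poly complex_of_real [:0, - (l1 * l2), l1 + l2 + l1 * l2, - (1 + l1 + l2), 1:]"
    unfolding cp by (simp add: map_poly_pCons algebra_simps)
  ultimately have eq: "map_poly complex_of_real [:0, - (a * d - b * c), a + d + (a * d - b * c), - (1 + a + d), 1:]
     = map_poly complex_of_real [:0, - (l1 * l2), l1 + l2 + l1 * l2, - (1 + l1 + l2), 1:]"
    by simp
  have coeff: "coeff [:0, - (a * d - b * c), a + d + (a * d - b * c), - (1 + a + d), 1:] n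
     = coeff [:0, - (l1 * l2), l1 + l2 + l1 * l2, - (1 + l1 + l2), 1:] n" for n
    using arg_cong[OF eq, of "\<lambda>p. coeff p n"] by (simp only: coeff_map_poly of_real_0 of_real_eq_iff)
  \<comment> \<open>Degree 3 yields the trace of that block and degree 1 its determinant.\<close>
  have tr: "a + d = l1 + l2" and dt: "a * d - b * c = l1 * l2"
    using coeff[of 3] coeff[of 1] by (simp_all add: numeral_eq_Suc)
  have ex: "\<exists>v\<in>W. v \<noteq> 0 \<and> A *v v = l *\<^sub>R v" if "l = l1 \<or> l = l2" for l
  proof -
    have "l * l - (a + d) * l + (a * d - b * c) = 0"
      unfolding tr dt using that by (auto simp: algebra_simps)
    then obtain s t where st: "s \<noteq> 0 \<or> t \<noteq> 0" "a * s + c * t = l * s" "b * s + d * t = l * t"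
      by (rule eigenvector_2x2)
    define v where "v = s *\<^sub>R u1 + t *\<^sub>R u2"
    have "v \<in> W"
      using B u subW by (auto simp: v_def subspace_add subspace_scale)
    moreover have "v \<noteq> 0"
    proof
      assume "v = 0"
      then have "(\<Sum>x\<in>{u1, u2}. (if x = u1 then s else t) *\<^sub>R x) = 0"
        using u(2) by (simp add: v_def)
      moreover have "independent {u1, u2}"
        using B u by simp
      ultimately have "(if x = u1 then s else t) = 0" if "x \<in> {u1, u2}" for x
        using independentD[of "{u1, u2}" "{u1, u2}" "\<lambda>x. if x = u1 then s else t" x] that by simp
      from this[of u1] this[of u2] show False
        using st(1) u(2) by simp
    qed
    moreover have "A *v v = (a * s + c * t) *\<^sub>R u1 + (b * s + d * t) *\<^sub>R u2"
      by (simp add: v_def matrix_vector_right_distrib matrix_vector_mult_scaleR Au1 Au2 algebra_simps)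
    then have "A *v v = l *\<^sub>R v"
      unfolding st by (simp add: v_def scaleR_add_right)
    ultimately show ?thesis by blast
  qed
  obtain v1 where v1: "v1 \<in> W" "v1 \<noteq> 0" "A *v v1 = l1 *\<^sub>R v1"
    using ex by blast
  obtain v2 where v2: "v2 \<in> W" "v2 \<noteq> 0" "A *v v2 = l2 *\<^sub>R v2"
    using ex by blast
  have "v1 \<notin> span {v2}"
  proof
    assume "v1 \<in> span {v2}"
    then obtain k where k: "v1 = k *\<^sub>R v2"
      by (auto simp: span_singleton)
    then have "l1 *\<^sub>R v1 = l2 *\<^sub>R v1"
      using v1(3) v2(3) by (auto simp: matrix_vector_mult_scaleR mult.commute)
    then show False
      using v1(2) \<open>l1 \<noteq> l2\<close> by simp
  qed
  then have "independent {v1, v2}" "v1 \<noteq> v2"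
    using v2(2) by (auto simp: independent_insert span_base)
  then have "W \<subseteq> span {v1, v2}"
    using v1(1) v2(1) dimW by (intro card_ge_dim_independent) auto
  then show thesis
    using v1 v2 surj by (intro that[of v1 v2]) (auto simp: W_def inner_vec_def h_def)
qed

section \<open>Spectrum of the linearization\<close>

text \<open>Conjugation by \<open>E\<close>, which is 1 on the x-axes and -1 on the y-axes, takes B
  to -B. So z - B and z + B have equal determinants, and their product z^2 - B^2 is diagonal with
  entries z^2 + 1 - l_i^2, each occurring once per axis. This determines the square of the
  characteristic polynomial.\<close>

lemma charpoly_stability_diagonal:
  fixes l :: "4 \<Rightarrow> real"
  defines "\<Lambda> \<equiv> \<chi> i j. if i = j then l i else 0"
  defines "B \<equiv> block_mat 0 (mat 1 - \<Lambda>) (- (mat 1 + \<Lambda>)) 0"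
  shows "(charpoly B)\<^sup>2 = (\<Prod>i\<in>UNIV. [:complex_of_real (1 - (l i)\<^sup>2), 0, 1:])\<^sup>2"
proof -
  have "poly ((charpoly B)\<^sup>2) z = poly ((\<Prod>i\<in>UNIV. [:complex_of_real (1 - (l i)\<^sup>2), 0, 1:])\<^sup>2) z" for z
  proof -
    define C where "C s = (\<chi> p q. (if p = q then z else 0) - s * complex_of_real (B $ p $ q))" for s
    define E :: "complex ^ (4 \<times> 2) ^ (4 \<times> 2)"
      where "E = (\<chi> p q. if p = q then if snd p = 1 then 1 else -1 else 0)"
    define G where "G p = z\<^sup>2 + complex_of_real (1 - (l (fst p))\<^sup>2)" for p :: "4 \<times> 2"
    have "E ** E = mat 1"
      by (simp add: vec_eq_iff E_def matrix_matrix_mult_def mat_def if_distrib[of "\<lambda>t. t * _"] cong: if_cong)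
    then have E: "det E * det E = 1"
      by (metis det_I det_mul)
    have B: "B $ (i, 1) $ (j, 1) = 0" "B $ (i, 2) $ (j, 2) = 0"
      "B $ (i, 1) $ (j, 2) = (if i = j then 1 - l i else 0)"
      "B $ (i, 2) $ (j, 1) = (if i = j then - (1 + l i) else 0)" for i j
      by (simp_all add: B_def \<Lambda>_def block_mat_def mat_def)
    have "E ** C 1 ** E = C (-1)"
    proof -
      have "(E ** C 1 ** E) $ p $ q = (if snd p = 1 then 1 else -1) * C 1 $ p $ q * (if snd q = 1 then 1 else -1)" for p q
        by (simp add: E_def matrix_matrix_mult_def if_distrib[of "\<lambda>t. t * _"] if_distrib[of "\<lambda>t. _ * t"] cong: if_cong)
      then show ?thesis
        by (intro config_eqI) (simp_all add: C_def B)
    qed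
    then have "det (C (-1)) = det E * det (C 1) * det E"
      by (metis det_mul)
    then have "det (C (-1)) = det (C 1)"
      using E by (simp add: mult.commute mult.assoc)
    moreover have "C 1 ** C (-1) = (\<chi> p q. if p = q then G p else 0)"
    proof -
      have C: "C s $ (i, 1) $ (j, 1) = (if i = j then z else 0)" "C s $ (i, 2) $ (j, 2) = (if i = j then z else 0)"
        "C s $ (i, 1) $ (j, 2) = (if i = j then - s * complex_of_real (1 - l i) else 0)"
        "C s $ (i, 2) $ (j, 1) = (if i = j then - s * complex_of_real (- (1 + l i)) else 0)" for s i j
        by (simp_all add: C_def B)
      show ?thesis
        by (intro config_eqI)
          (simp_all add: matrix_matrix_mult_def sum_axes C G_def sum.distrib if_distrib[of "\<lambda>t. t * _"]
            cong: if_cong, simp_all add: algebra_simps power2_eq_square)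
    qed
    ultimately have "(det (C 1))\<^sup>2 = det (\<chi> p q. if p = q then G p else 0)"
      by (metis det_mul power2_eq_square)
    also have "\<dots> = (\<Prod>p\<in>UNIV. G p)"
      by (simp add: det_diagonal)
    also have "\<dots> = (\<Prod>i\<in>UNIV. \<Prod>k\<in>(UNIV :: 2 set). G (i, k))"
      by (simp add: prod.cartesian_product)
    also have "\<dots> = (\<Prod>i\<in>UNIV. z\<^sup>2 + complex_of_real (1 - (l i)\<^sup>2))\<^sup>2"
      by (simp add: G_def prod_power_distrib)
    finally show ?thesis
      by (simp add: poly_charpoly C_def poly_prod power2_eq_square algebra_simps)
  qed
  then show ?thesis
    by (simp add: poly_eq_poly_eq_iff[symmetric] ext)
qed

lemma proots_square_plus:
  "proots [:complex_of_real (b\<^sup>2), 0, 1:] = {#\<i> * complex_of_real b, - (\<i> * complex_of_real b)#}"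
proof -
  have "[:complex_of_real (b\<^sup>2), 0, 1:] = [:- (\<i> * complex_of_real b), 1:] * [:\<i> * complex_of_real b, 1:]"
    by (simp add: power2_eq_square algebra_simps)
  also have "proots \<dots> = proots [:- (\<i> * complex_of_real b), 1:] + proots [:\<i> * complex_of_real b, 1:]"
    by (rule proots_mult) simp_all
  finally show ?thesis
    by (simp del: of_real_power)
qed

lemma mat_1_minus_mult: "(mat 1 - A) ** P = P - A ** P"
  and mult_mat_1_minus: "P ** (mat 1 - A) = P - P ** A"
  and minus_mat_1_plus_mult: "(- (mat 1 + A)) ** P = - P - A ** P"
  and mult_minus_mat_1_plus: "P ** (- (mat 1 + A)) = - P - P ** A"
  for A P :: "real ^ 'n ^ 'n"
  by (simp_all add: vec_eq_iff matrix_matrix_mult_def mat_def algebra_simps sum.distrib sum_subtractf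
      sum_negf if_distrib[of "\<lambda>t. t * _"] if_distrib[of "\<lambda>t. _ * t"] cong: if_cong)

text \<open>Using \<open>P\<close> on both axes diagonalizes all blocks at once. The eigenvalue 0 of
  \<open>A\<close> yields z^2 + 1 and the eigenvalue 1 yields z^2; these account for the trivial
  eigenvalues.\<close>

lemma eigenvals_stability_matrix:
  fixes A P :: "real ^ 4 ^ 4"
  assumes AP: "A ** P = P ** (\<chi> i j. if i = j then l i else 0)" and P: "det P \<noteq> 0"
    and l: "l 1 = 0" "l 2 = 1" "\<bar>l 3\<bar> < 1" "\<bar>l 4\<bar> < 1"
  shows "eigenvals (block_mat 0 (mat 1 - A) (- (mat 1 + A)) 0) - {#0, 0, \<i>, - \<i>#} =
    {#\<i> * complex_of_real (sqrt (1 - (l 3)\<^sup>2)), - (\<i> * complex_of_real (sqrt (1 - (l 3)\<^sup>2))),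
      \<i> * complex_of_real (sqrt (1 - (l 4)\<^sup>2)), - (\<i> * complex_of_real (sqrt (1 - (l 4)\<^sup>2)))#}"
proof -
  define \<Lambda> where "\<Lambda> = (\<chi> i j. if i = j then l i else 0)"
  define B where "B X = block_mat 0 (mat 1 - X) (- (mat 1 + X)) 0" for X
  obtain R where R: "P ** R = mat 1"
    using P invertible_det_nz invertible_right_inverse by blast
  have "block_mat P 0 0 P ** block_mat R 0 0 R = mat 1"
    by (simp add: block_mat_mult R mat_1_eq_block_mat)
  then have det: "det (block_mat P 0 0 P) \<noteq> 0"
    by (metis det_I det_mul mult_zero_left zero_neq_one)
  have "B A ** block_mat P 0 0 P = block_mat P 0 0 P ** B \<Lambda>"
  proof -
    have "(mat 1 - A) ** P = P ** (mat 1 - \<Lambda>)" "(- (mat 1 + A)) ** P = P ** (- (mat 1 + \<Lambda>))"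
      using AP unfolding \<Lambda>_def[symmetric]
      by (simp_all only: mat_1_minus_mult mult_mat_1_minus minus_mat_1_plus_mult mult_minus_mat_1_plus)
    then show ?thesis
      by (simp only: B_def block_mat_mult) simp
  qed
  then have sim: "charpoly (B A) = charpoly (B \<Lambda>)"
    using det by (rule charpoly_similar)
  define b3 b4 where "b3 = sqrt (1 - (l 3)\<^sup>2)" and "b4 = sqrt (1 - (l 4)\<^sup>2)"
  have b: "1 - (l 3)\<^sup>2 = b3\<^sup>2" "1 - (l 4)\<^sup>2 = b4\<^sup>2" "1 - (l 1)\<^sup>2 = 1\<^sup>2" "1 - (l 2)\<^sup>2 = 0\<^sup>2"
    using l abs_square_le_1[of "l 3"] abs_square_le_1[of "l 4"] by (simp_all add: b3_def b4_def)
  define S where "S t = [:complex_of_real (t\<^sup>2), 0, 1:]" for t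
  have S0: "S t \<noteq> 0" for t
    by (simp add: S_def)
  have prod_4: "(\<Prod>i\<in>UNIV. f i) = f 1 * f 2 * f 3 * f 4" for f :: "4 \<Rightarrow> complex poly"
    unfolding UNIV_4 by (simp add: ac_simps)
  have "(charpoly (B \<Lambda>))\<^sup>2 = (S 1 * S 0 * S b3 * S b4)\<^sup>2"
    unfolding B_def \<Lambda>_def charpoly_stability_diagonal prod_4 b S_def ..
  \<comment> \<open>The sign left open by the squares does not affect the multiset of roots.\<close>
  then have "charpoly (B \<Lambda>) = S 1 * S 0 * S b3 * S b4 \<or> charpoly (B \<Lambda>) = - (S 1 * S 0 * S b3 * S b4)"
    by (simp only: power2_eq_iff)
  then have "eigenvals (B A) = proots (S 1 * S 0 * S b3 * S b4)"
    unfolding eigenvals_def sim by (metis proots_uminus)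
  also have "\<dots> = proots (S 1) + proots (S 0) + proots (S b3) + proots (S b4)"
    by (simp add: proots_mult S0)
  finally show ?thesis
    unfolding S_def proots_square_plus b3_def b4_def B_def by simp
qed

section \<open>Rotation blocks on the complement of the trivial directions\<close>

text \<open>V is spanned by (y, 0) and (0, -y), so orthogonality splits into the same condition on
  each axis.\<close>

lemma join_in_V_perp_iff:
  "join u v \<in> V_perp \<Gamma> (on_line y) \<longleftrightarrow>
    (\<Sum>i\<in>UNIV. \<Gamma> $ i * y $ i * u $ i) = 0 \<and> (\<Sum>i\<in>UNIV. \<Gamma> $ i * y $ i * v $ i) = 0"
proof -
  have M: "M_mat \<Gamma> *v join a b = join (\<chi> i. \<Gamma> $ i * a $ i) (\<chi> i. \<Gamma> $ i * b $ i)" for a b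
  proof -
    have "(\<chi> i j. if i = j then \<Gamma> $ i else 0) *v a = (\<chi> i. \<Gamma> $ i * a $ i)" for a
      by (simp add: vec_eq_iff matrix_vector_mult_def if_distrib[of "\<lambda>t. t * _"] cong: if_cong)
    then show ?thesis
      by (simp add: M_mat_eq_block_mat block_mat_mult_join)
  qed
  have neg: "(- mat 1) *v y = - y"
    by (simp add: vec_eq_iff matrix_vector_mult_def mat_def if_distrib[of "\<lambda>t. t * _"] sum_negf cong: if_cong)
  have K: "K_mat *v on_line y = join 0 (- y)"
    by (simp add: K_mat_eq_block_mat on_line_eq_join block_mat_mult_join neg)
  have ip: "join u v \<bullet> (M_mat \<Gamma> *v (k *\<^sub>R join y 0 + l *\<^sub>R join 0 (- y))) =
      k * (\<Sum>i\<in>UNIV. \<Gamma> $ i * y $ i * u $ i) - l * (\<Sum>i\<in>UNIV. \<Gamma> $ i * y $ i * v $ i)" for k l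
    by (simp add: join_add join_scaleR M inner_join)
      (simp add: inner_vec_def sum_distrib_left sum_negf mult_ac)
  have mem: "k *\<^sub>R join y 0 + l *\<^sub>R join 0 (- y) \<in> span {join y 0, join 0 (- y)}" for k l
    by (intro span_add span_scale span_base) auto
  show ?thesis
  proof
    assume "join u v \<in> V_perp \<Gamma> (on_line y)"
    then have orth: "join u v \<bullet> (M_mat \<Gamma> *v (k *\<^sub>R join y 0 + l *\<^sub>R join 0 (- y))) = 0" for k l
      using mem unfolding V_perp_def V_space_def K by (simp add: on_line_eq_join)
    show "(\<Sum>i\<in>UNIV. \<Gamma> $ i * y $ i * u $ i) = 0 \<and> (\<Sum>i\<in>UNIV. \<Gamma> $ i * y $ i * v $ i) = 0"
      using ip[of 1 0] ip[of 0 1] unfolding orth by simp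
  next
    assume "(\<Sum>i\<in>UNIV. \<Gamma> $ i * y $ i * u $ i) = 0 \<and> (\<Sum>i\<in>UNIV. \<Gamma> $ i * y $ i * v $ i) = 0"
    then have "join u v \<bullet> (M_mat \<Gamma> *v (k *\<^sub>R join y 0 + l *\<^sub>R join 0 (- y))) = 0" for k l
      using ip by simp
    then show "join u v \<in> V_perp \<Gamma> (on_line y)"
      unfolding V_perp_def V_space_def K by (auto simp: on_line_eq_join elim!: in_span_pairD)
  qed
qed

text \<open>For an eigenvector v of \<open>A\<close> with eigenvalue l, B sends (v, 0) to (0, -(1 +
  l) v) and (0, v) to ((1 - l) v, 0). Rescaling the second vector by the root of (1 + l) / (1 - l)
  makes the two coefficients opposite, with \<beta>^2 = 1 - l^2. The vector 1 contributes a third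
  block, with l = 0.\<close>

lemma rotation_block_form_V_perp:
  fixes A :: "real ^ 4 ^ 4" and \<Gamma> y v1 v2 :: "real ^ 4"
  assumes gyy: "(\<Sum>i\<in>UNIV. \<Gamma> $ i * y $ i * y $ i) \<noteq> 0"
    and gy: "(\<Sum>i\<in>UNIV. \<Gamma> $ i * y $ i) = 0"
    and gv: "(\<Sum>i\<in>UNIV. \<Gamma> $ i * y $ i * v1 $ i) = 0" "(\<Sum>i\<in>UNIV. \<Gamma> $ i * y $ i * v2 $ i) = 0"
    and ev: "A *v 1 = 0" "A *v v1 = l1 *\<^sub>R v1" "A *v v2 = l2 *\<^sub>R v2"
    and l: "\<bar>l1\<bar> < 1" "\<bar>l2\<bar> < 1"
    and surj: "surj ((*v) (columns4 1 y v1 v2))"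
  shows "rotation_block_form (block_mat 0 (mat 1 - A) (- (mat 1 + A)) 0) (V_perp \<Gamma> (on_line y))"
proof -
  define B where "B = block_mat 0 (mat 1 - A) (- (mat 1 + A)) 0"
  define s1 s2 where "s1 = sqrt ((1 + l1) / (1 - l1))" and "s2 = sqrt ((1 + l2) / (1 - l2))"
  have s: "s1 > 0" "s2 > 0"
    using l by (auto simp: s1_def s2_def)
  have ss: "s1 * s1 * (1 - l1) = 1 + l1" "s2 * s2 * (1 - l2) = 1 + l2"
    using l by (auto simp: s1_def s2_def)
  have Bjoin: "B *v join u v = join (v - A *v v) (- (u + A *v u))" for u v
  proof -
    have "(mat 1 - A) *v v = v - A *v v" "(- (mat 1 + A)) *v u = - (u + A *v u)"
      by (simp_all add: vec_eq_iff matrix_vector_mult_def mat_def algebra_simps sum.distrib sum_subtractf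
          sum_negf if_distrib[of "\<lambda>t. t * _"] if_distrib[of "\<lambda>t. _ * t"] cong: if_cong)
    then show ?thesis
      by (simp only: B_def block_mat_mult_join) simp
  qed
  define bs where "bs = [join 1 0, join 0 1, join v1 0, join 0 (s1 *\<^sub>R v1), join v2 0, join 0 (s2 *\<^sub>R v2)]"
  \<comment> \<open>Adding the two copies of \<open>y\<close> gives eight vectors spanning the
    eight-dimensional space. They are therefore distinct and independent, and \<open>bs\<close>
    inherits this.\<close>
  define ws where "ws = bs @ [join y 0, join 0 y]"
  have comb: "\<exists>a b c d. u = a *\<^sub>R 1 + b *\<^sub>R y + c *\<^sub>R v1 + d *\<^sub>R v2" for u
  proof -
    obtain w where "u = columns4 1 y v1 v2 *v w"
      using surj by blast
    then show ?thesis unfolding columns4_mult_vector by blast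
  qed
  have base: "join 1 0 \<in> span (set bs)" "join 0 1 \<in> span (set bs)" "join v1 0 \<in> span (set bs)"
    "join v2 0 \<in> span (set bs)" "join 0 v1 \<in> span (set bs)" "join 0 v2 \<in> span (set bs)"
  proof -
    show "join 1 0 \<in> span (set bs)" "join 0 1 \<in> span (set bs)" "join v1 0 \<in> span (set bs)"
      "join v2 0 \<in> span (set bs)"
      by (auto simp: bs_def intro: span_base)
    have "(1 / s1) *\<^sub>R join 0 (s1 *\<^sub>R v1) \<in> span (set bs)" "(1 / s2) *\<^sub>R join 0 (s2 *\<^sub>R v2) \<in> span (set bs)"
      by (intro span_scale span_base; simp add: bs_def)+
    then show "join 0 v1 \<in> span (set bs)" "join 0 v2 \<in> span (set bs)"
      using s by (simp_all add: join_scaleR)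
  qed
  have split: "join u v = join u 0 + join 0 v" for u v
    by (simp add: join_add)
  have exp: "join (a *\<^sub>R 1 + b *\<^sub>R y + c *\<^sub>R v1 + d *\<^sub>R v2) (a' *\<^sub>R 1 + b' *\<^sub>R y + c' *\<^sub>R v1 + d' *\<^sub>R v2) =
      (a *\<^sub>R join 1 0 + c *\<^sub>R join v1 0 + d *\<^sub>R join v2 0 + a' *\<^sub>R join 0 1 + c' *\<^sub>R join 0 v1 + d' *\<^sub>R join 0 v2)
      + (b *\<^sub>R join y 0 + b' *\<^sub>R join 0 y)" for a b c d a' b' c' d'
    by (simp add: join_add join_scaleR algebra_simps)
  have in_bs: "a *\<^sub>R join 1 0 + c *\<^sub>R join v1 0 + d *\<^sub>R join v2 0 + a' *\<^sub>R join 0 1 + c' *\<^sub>R join 0 v1 + d' *\<^sub>R join 0 v2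
      \<in> span (set bs)" for a c d a' c' d'
    by (intro span_add span_scale base)
  have "span (set ws) = UNIV"
  proof -
    have "x \<in> span (set ws)" for x
    proof -
      obtain u v where x: "x = join u v" by (rule join_cases)
      obtain a b c d a' b' c' d' where uv: "u = a *\<^sub>R 1 + b *\<^sub>R y + c *\<^sub>R v1 + d *\<^sub>R v2"
        "v = a' *\<^sub>R 1 + b' *\<^sub>R y + c' *\<^sub>R v1 + d' *\<^sub>R v2"
        using comb by metis
      have "span (set bs) \<subseteq> span (set ws)"
        by (intro span_mono) (auto simp: ws_def)
      moreover have "join y 0 \<in> span (set ws)" "join 0 y \<in> span (set ws)"
        by (auto simp: ws_def intro: span_base)
      ultimately show ?thesis
        unfolding x uv exp using base by (intro span_add span_scale) blast+
    qed
    then show ?thesis by blast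
  qed
  then have "dim (set ws) = DIM(config)"
    by (metis dim_span dim_UNIV)
  then have dim: "dim (set ws) = 8"
    by simp
  have len: "length ws = 8"
    by (simp add: ws_def bs_def)
  have "8 \<le> card (set ws)"
    using dim dim_le_card'[of "set ws"] by simp
  then have card: "card (set ws) = length ws"
    using len card_length[of ws] by simp
  then have "distinct ws"
    by (rule card_distinct)
  moreover have "independent (set ws)"
    using card len dim by (intro card_le_dim_spanning[of _ "set ws"]) (auto simp: span_superset)
  ultimately have di: "distinct bs" "independent (set bs)"
    using independent_mono[of "set ws" "set bs"] by (auto simp: ws_def)
  have sp: "span (set bs) = V_perp \<Gamma> (on_line y)"
  proof
    have sum_scale: "(\<Sum>i\<in>UNIV. \<Gamma> $ i * y $ i * (c *\<^sub>R v) $ i) = c * (\<Sum>i\<in>UNIV. \<Gamma> $ i * y $ i * v $ i)" for c and v :: "real ^ 4"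
      by (simp add: sum_distrib_left mult_ac)
    have "subspace (V_perp \<Gamma> (on_line y))"
      by (auto simp: V_perp_def subspace_def inner_left_distrib)
    moreover have "set bs \<subseteq> V_perp \<Gamma> (on_line y)"
      using gy gv sum_scale by (simp add: bs_def join_in_V_perp_iff)
    ultimately show "span (set bs) \<subseteq> V_perp \<Gamma> (on_line y)"
      by (simp add: span_minimal)
    \<comment> \<open>Pairing with \<open>y\<close> in the weighted form isolates the coefficient of
      \<open>y\<close>, as the other three vectors are orthogonal to it and \<open>y\<close> is not
      isotropic.\<close>
    have b0: "b = 0" if "u = a *\<^sub>R 1 + b *\<^sub>R y + c *\<^sub>R v1 + d *\<^sub>R v2" "(\<Sum>i\<in>UNIV. \<Gamma> $ i * y $ i * u $ i) = 0" for u a b c d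
    proof -
      have "(\<Sum>i\<in>UNIV. \<Gamma> $ i * y $ i * u $ i) = a * (\<Sum>i\<in>UNIV. \<Gamma> $ i * y $ i)
         + b * (\<Sum>i\<in>UNIV. \<Gamma> $ i * y $ i * y $ i) + c * (\<Sum>i\<in>UNIV. \<Gamma> $ i * y $ i * v1 $ i)
         + d * (\<Sum>i\<in>UNIV. \<Gamma> $ i * y $ i * v2 $ i)"
        unfolding that(1) by (simp add: distrib_left sum.distrib sum_distrib_left mult_ac)
      then show ?thesis
        using that(2) gyy gy gv by simp
    qed
    show "V_perp \<Gamma> (on_line y) \<subseteq> span (set bs)"
    proof
      fix x assume "x \<in> V_perp \<Gamma> (on_line y)"
      obtain u v where x: "x = join u v" by (rule join_cases)
      have uv: "(\<Sum>i\<in>UNIV. \<Gamma> $ i * y $ i * u $ i) = 0" "(\<Sum>i\<in>UNIV. \<Gamma> $ i * y $ i * v $ i) = 0"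
        using \<open>x \<in> V_perp \<Gamma> (on_line y)\<close> by (simp_all add: x join_in_V_perp_iff)
      obtain a b c d a' b' c' d' where e: "u = a *\<^sub>R 1 + b *\<^sub>R y + c *\<^sub>R v1 + d *\<^sub>R v2"
        "v = a' *\<^sub>R 1 + b' *\<^sub>R y + c' *\<^sub>R v1 + d' *\<^sub>R v2"
        using comb by metis
      have "b = 0" "b' = 0"
        using b0[OF e(1) uv(1)] b0[OF e(2) uv(2)] by simp_all
      then show "x \<in> span (set bs)"
        unfolding x e exp using in_bs by simp
    qed
  qed
  define \<beta> where "\<beta> i = (if i = 0 then 1 else if i = 1 then s1 * (1 - l1) else s2 * (1 - l2))" for i :: nat
  have "\<forall>i<3. B *v (bs ! (2 * i)) = - \<beta> i *\<^sub>R bs ! (2 * i + 1) \<and> B *v (bs ! (2 * i + 1)) = \<beta> i *\<^sub>R bs ! (2 * i)"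
  proof -
    have "B *v join v 0 = - (t * (1 - l)) *\<^sub>R join 0 (t *\<^sub>R v) \<and> B *v join 0 (t *\<^sub>R v) = (t * (1 - l)) *\<^sub>R join v 0"
      if "A *v v = l *\<^sub>R v" "t * t * (1 - l) = 1 + l" for t l v
    proof -
      have t: "t * (1 - l) * t = 1 + l"
        using that(2) by (simp add: mult_ac)
      have "B *v join v 0 = join 0 (- (1 + l) *\<^sub>R v)"
        using that(1) by (simp add: Bjoin algebra_simps)
      also have "\<dots> = - (t * (1 - l)) *\<^sub>R join 0 (t *\<^sub>R v)"
        by (simp only: join_scaleR scaleR_scaleR scaleR_zero_right mult_minus_left t)
      finally show ?thesis
        using that(1) by (simp add: Bjoin join_scaleR matrix_vector_mult_scaleR algebra_simps)
    qed
    from this[OF ev(2) ss(1)] this[OF ev(3) ss(2)] show ?thesis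
      by (simp add: numeral_eq_Suc All_less_Suc2 bs_def \<beta>_def Bjoin ev(1) join_scaleR join_minus)
  qed
  moreover have "length bs = 2 * 3"
    by (simp add: bs_def)
  ultimately show ?thesis
    unfolding rotation_block_form_def B_def[symmetric] using di sp by blast
qed

text \<open>Multiply the equation of vortex i by \<Gamma>_i y_i and add up; the two contributions of
  each pair combine to \<Gamma>_i \<Gamma>_j. Consequently L nonzero means that \<open>y\<close> is
  not isotropic for the weighted form.\<close>

lemma weighted_moment_of_inertia:
  assumes re: "relative_equilibrium \<Gamma> \<omega> (on_line x)"
  defines "y \<equiv> \<chi> i. x $ i - center \<Gamma> (on_line x) $ 1"
  shows "\<omega> * (\<Sum>i\<in>UNIV. \<Gamma> $ i * y $ i * y $ i) = L \<Gamma>"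
proof -
  note R = collinear_relative_equilibriumD[OF re]
  define f where "f i j = \<Gamma> $ i * \<Gamma> $ j * y $ i * (x $ i - x $ j) / (x $ i - x $ j)\<^sup>2" for i j
  have pair: "f i j = \<Gamma> $ i * \<Gamma> $ j - f j i" if "i \<noteq> j" for i j
  proof -
    define e where "e = x $ i - x $ j"
    have e: "e \<noteq> 0" "x $ j - x $ i = - e" "y $ i = y $ j + e"
      using R(3)[OF that] by (simp_all add: y_def e_def)
    show ?thesis
      unfolding f_def e_def[symmetric] e(2,3) using e(1)
      by (simp add: power2_eq_square field_simps)
  qed
  have "\<omega> * (\<Sum>i\<in>UNIV. \<Gamma> $ i * y $ i * y $ i) = (\<Sum>i\<in>UNIV. \<Gamma> $ i * y $ i * (\<omega> * y $ i))"
    by (simp add: sum_distrib_left mult_ac)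
  also have "\<dots> = (\<Sum>i\<in>UNIV. \<Sum>j\<in>UNIV - {i}. f i j)"
  proof (intro sum.cong refl)
    fix i :: 4
    have "\<omega> * y $ i = (\<Sum>j\<in>UNIV - {i}. \<Gamma> $ j * (x $ i - x $ j) / (x $ i - x $ j)\<^sup>2)"
      using R(4)[of i] by (simp add: y_def R(5))
    then show "\<Gamma> $ i * y $ i * (\<omega> * y $ i) = (\<Sum>j\<in>UNIV - {i}. f i j)"
      by (simp add: f_def sum_distrib_left mult_ac)
  qed
  also have "\<dots> = L \<Gamma>"
    unfolding L_def sum_pairs_4
    by (simp add: sum_diff1 sum_4 pair[of 1 2] pair[of 1 3] pair[of 1 4] pair[of 2 3] pair[of 2 4] pair[of 3 4] mult.commute)
  finally show ?thesis .
qed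

text \<open>D < T^2 / 4 makes the discriminant \<open>s\<^sup>2\<close> positive. The last two
  hypotheses say that the quadratic is positive at 1 and -1, that is, \<open>s\<^sup>2\<close> < (2
  - T)^2 and \<open>s\<^sup>2\<close> < (2 + T)^2. As 2 - T and 2 + T are positive, both roots (T +
  s) / 2 and (T - s) / 2 lie in (-1, 1).\<close>

lemma quadratic_roots_in_unit_interval:
  fixes T D :: real
  assumes "-2 < T" "T < 2" "D < T\<^sup>2 / 4" "D > T - 1" "D > - T - 1"
  obtains l1 l2 where "l1 \<noteq> l2" "\<bar>l1\<bar> < 1" "\<bar>l2\<bar> < 1" "l1 + l2 = T" "l1 * l2 = D"
proof -
  define s where "s = sqrt (T\<^sup>2 - 4 * D)"
  have s0: "s > 0" and ss: "s\<^sup>2 = T\<^sup>2 - 4 * D"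
    using assms(3) by (simp_all add: s_def)
  have "s\<^sup>2 < (2 - T)\<^sup>2" "s\<^sup>2 < (2 + T)\<^sup>2"
    using assms unfolding ss by (simp_all add: power2_eq_square algebra_simps)
  then have "s < 2 - T" "s < 2 + T"
    using assms by (auto intro: power2_less_imp_less)
  moreover have "(T + s) / 2 * ((T - s) / 2) = D"
    using ss by (simp add: power2_eq_square algebra_simps)
  ultimately show thesis
    using s0 assms by (intro that[of "(T + s) / 2" "(T - s) / 2"]) (auto simp: field_simps)
qed

lemma linearly_stable_collinear:
  fixes \<Gamma> x :: "real ^ 4" and \<omega> :: real
  defines "T \<equiv> T_coeff \<Gamma> \<omega> (on_line x)" and "D \<equiv> D_coeff \<Gamma> \<omega> (on_line x)"
  assumes re: "relative_equilibrium \<Gamma> \<omega> (on_line x)" and L: "L \<Gamma> \<noteq> 0" and \<Gamma>: "\<And>i. \<Gamma> $ i \<noteq> 0"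
    and TD: "-2 < T" "T < 2" "D < T\<^sup>2 / 4" "D > T - 1" "D > - T - 1"
  shows "linearly_stable \<Gamma> \<omega> (on_line x)"
proof -
  note R = collinear_relative_equilibriumD[OF re]
  define c where "c = center \<Gamma> (on_line x) $ 1"
  define y where "y = (\<chi> i. x $ i - c)"
  have cent: "centered \<Gamma> (on_line x) = on_line y"
  proof -
    have on: "on_line u $ (i, 1) = u $ i" "on_line u $ (i, 2) = 0" for u i
      by (simp_all add: on_line_def)
    show ?thesis
      by (intro config_eqI) (simp_all add: centered_def on y_def c_def R(6))
  qed
  \<comment> \<open>The matrix depends on differences of positions only, so it is the same before
    and after centering.\<close>
  define A where "A = A_mat \<Gamma> \<omega> (on_line y)"
  have A: "A = A_mat \<Gamma> \<omega> (on_line x)"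
    by (simp add: A_def A_mat_def vec_eq_iff r_on_line y_def)
  have inj: "inj (($) y)"
    using R(3) by (intro injI) (auto simp: y_def)
  have B: "stability_matrix \<Gamma> \<omega> (on_line y) = block_mat 0 (mat 1 - A) (- (mat 1 + A)) 0"
    unfolding A_def by (rule stability_matrix_on_line[OF inj R(2) \<Gamma>])
  have ev: "A *v 1 = 0" "A *v y = y"
    unfolding A y_def c_def by (rule A_mat_eigenvector_0, rule A_mat_eigenvector_1[OF re])
  have g1: "(\<Sum>i\<in>UNIV. \<Gamma> $ i) \<noteq> 0"
    using R(1) by (simp add: total_circ_def)
  have "c * total_circ \<Gamma> = (\<Sum>i\<in>UNIV. \<Gamma> $ i * x $ i)"
    using R(1) by (simp add: c_def R(5))
  then have gy: "(\<Sum>i\<in>UNIV. \<Gamma> $ i * y $ i) = 0"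
    by (simp add: y_def right_diff_distrib sum_subtractf sum_distrib_left total_circ_def mult.commute)
  have gyy: "(\<Sum>i\<in>UNIV. \<Gamma> $ i * y $ i * y $ i) \<noteq> 0"
    using weighted_moment_of_inertia[OF re] L by (auto simp: y_def c_def)
  obtain l1 l2 where l: "l1 \<noteq> l2" "\<bar>l1\<bar> < 1" "\<bar>l2\<bar> < 1" "l1 + l2 = T" "l1 * l2 = D"
    using quadratic_roots_in_unit_interval[OF TD] .
  have cp: "charpoly A = [:0, 1:] * [:-1, 1:] * [:complex_of_real (l1 * l2), - complex_of_real (l1 + l2), 1:]"
    unfolding A l(4,5) T_def D_def by (rule charpoly_A_mat[OF re])
  have sym: "\<Gamma> $ i * A $ i $ j = \<Gamma> $ j * A $ j $ i" for i j
    unfolding A by (rule weighted_A_mat_symmetric)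
  obtain v1 v2 where v: "A *v v1 = l1 *\<^sub>R v1" "A *v v2 = l2 *\<^sub>R v2"
    "(\<Sum>i\<in>UNIV. \<Gamma> $ i * y $ i * v1 $ i) = 0" "(\<Sum>i\<in>UNIV. \<Gamma> $ i * y $ i * v2 $ i) = 0"
    "surj ((*v) (columns4 1 y v1 v2))"
    by (rule nontrivial_eigenvectors[OF sym ev g1 gy gyy cp l(1)])
  \<comment> \<open>The eigenvalues are listed in the order of the columns 1, y, v1, v2.\<close>
  define l where "l i = (if i = 1 then 0 else if i = 2 then 1 else if i = 3 then l1 else l2)" for i :: 4
  have "A ** columns4 1 y v1 v2 = columns4 1 y v1 v2 ** (\<chi> i j. if i = j then l i else 0)"
    unfolding mult_columns4 ev v(1,2)
    by (simp add: vec_eq_iff columns4_def matrix_matrix_mult_def l_def if_distrib[of "\<lambda>t. _ * t"] cong: if_cong)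
  then have eig: "eigenvals (stability_matrix \<Gamma> \<omega> (on_line y)) - {#0, 0, \<i>, - \<i>#} =
    {#\<i> * complex_of_real (sqrt (1 - l1\<^sup>2)), - (\<i> * complex_of_real (sqrt (1 - l1\<^sup>2))),
      \<i> * complex_of_real (sqrt (1 - l2\<^sup>2)), - (\<i> * complex_of_real (sqrt (1 - l2\<^sup>2)))#}"
    unfolding B using eigenvals_stability_matrix[of A "columns4 1 y v1 v2" l] det_nonzero_of_surj[OF v(5)]
      \<open>\<bar>l1\<bar> < 1\<close> \<open>\<bar>l2\<bar> < 1\<close> by (simp add: l_def)
  have "l1\<^sup>2 < 1" "l2\<^sup>2 < 1"
    using \<open>\<bar>l1\<bar> < 1\<close> \<open>\<bar>l2\<bar> < 1\<close> by (simp_all add: abs_square_less_1)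
  then have "\<forall>\<mu>\<in>#eigenvals (stability_matrix \<Gamma> \<omega> (on_line y)) - {#0, 0, \<i>, - \<i>#}. \<mu> \<noteq> 0 \<and> Re \<mu> = 0"
    unfolding eig by auto
  moreover have "rotation_block_form (stability_matrix \<Gamma> \<omega> (on_line y)) (V_perp \<Gamma> (on_line y))"
    unfolding B by (rule rotation_block_form_V_perp[OF gyy gy v(3,4) ev(1) v(1,2) \<open>\<bar>l1\<bar> < 1\<close> \<open>\<bar>l2\<bar> < 1\<close> v(5)])
  ultimately show ?thesis
    by (simp add: linearly_stable_def cent Let_def)
qed

theorem theorem3p5:
  fixes \<Gamma> x :: "real ^ 4" and \<omega> T D :: real
  assumes "relative_equilibrium \<Gamma> \<omega> (on_line x)"
    and "L \<Gamma> \<noteq> 0"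
    and "T = T_coeff \<Gamma> \<omega> (on_line x)"
    and "D = D_coeff \<Gamma> \<omega> (on_line x)"
  shows
    "nontrivial_eigenvals_A \<Gamma> \<omega> (on_line x)
       = proots [:complex_of_real D, - complex_of_real T, 1:]
     \<and> (\<forall>m G x' \<omega>'.
          \<Gamma>$1 = 1 \<and> \<Gamma>$2 = 1 \<and> \<Gamma>$3 = 1 \<and> \<Gamma>$4 = m \<and> G \<in> {group_I, group_II} \<and>
          relative_equilibrium \<Gamma> \<omega>' (on_line x') \<and> normalized_in G x \<and> normalized_in G x'
          \<longrightarrow> nontrivial_eigenvals_A \<Gamma> \<omega> (on_line x) = nontrivial_eigenvals_A \<Gamma> \<omega>' (on_line x'))
     \<and> ((\<forall>i. \<Gamma> $ i \<noteq> 0) \<and> -2 < T \<and> T < 2 \<and> D < T\<^sup>2 / 4 \<and> D > T - 1 \<and> D > - T - 1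
          \<longrightarrow> linearly_stable \<Gamma> \<omega> (on_line x))"
proof (intro conjI)
  note re = assms(1) and L = assms(2)
  show "nontrivial_eigenvals_A \<Gamma> \<omega> (on_line x)
      = proots [:complex_of_real D, - complex_of_real T, 1:]"
    unfolding assms(3,4) by (rule nontrivial_eigenvals_A_eq[OF re])
  show "\<forall>m G x' \<omega>'.
      \<Gamma>$1 = 1 \<and> \<Gamma>$2 = 1 \<and> \<Gamma>$3 = 1 \<and> \<Gamma>$4 = m \<and> G \<in> {group_I, group_II} \<and>
      relative_equilibrium \<Gamma> \<omega>' (on_line x') \<and> normalized_in G x \<and> normalized_in G x'
      \<longrightarrow> nontrivial_eigenvals_A \<Gamma> \<omega> (on_line x) = nontrivial_eigenvals_A \<Gamma> \<omega>' (on_line x')"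
  proof (intro allI impI, elim conjE)
    fix m G x' \<omega>'
    assume \<Gamma>: "\<Gamma>$1 = 1" "\<Gamma>$2 = 1" "\<Gamma>$3 = 1" and G: "G \<in> {group_I, group_II}"
      and re': "relative_equilibrium \<Gamma> \<omega>' (on_line x')"
      and norm: "normalized_in G x" "normalized_in G x'"
    show "nontrivial_eigenvals_A \<Gamma> \<omega> (on_line x) = nontrivial_eigenvals_A \<Gamma> \<omega>' (on_line x')"
    proof (rule nontrivial_eigenvals_A_unique[OF re re' \<Gamma> L])
      from G consider "G = group_I" | "G = group_II" by blast
      then show "x $ 1 < x $ 4 \<and> x $ 2 < x $ 4 \<and> x $ 3 < x $ 4 \<or> x $ 4 < x $ 1 \<and> x $ 4 < x $ 2 \<and> x $ 4 < x $ 3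
        \<longleftrightarrow> x' $ 1 < x' $ 4 \<and> x' $ 2 < x' $ 4 \<and> x' $ 3 < x' $ 4 \<or> x' $ 4 < x' $ 1 \<and> x' $ 4 < x' $ 2 \<and> x' $ 4 < x' $ 3"
      proof cases
        case 1
        show ?thesis
          using norm normalized_in_group_I[of x] normalized_in_group_I[of x'] unfolding 1 by blast
      next
        case 2
        show ?thesis
          using norm normalized_in_group_II[of x] normalized_in_group_II[of x'] unfolding 2 by blast
      qed
    qed
  qed
  show "(\<forall>i. \<Gamma> $ i \<noteq> 0) \<and> -2 < T \<and> T < 2 \<and> D < T\<^sup>2 / 4 \<and> D > T - 1 \<and> D > - T - 1
      \<longrightarrow> linearly_stable \<Gamma> \<omega> (on_line x)"
    using linearly_stable_collinear[OF re L] unfolding assms(3,4) by blast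
qed

end
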